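(* For every integer $v \ge 8$ there exists at least one lune-free knot graph with exactly $v$ vertices.
   Context: A lune-free graph is a connected $4$-regular plane graph with no loops and no multiple edges (at most one edge between any two vertices). In a $4$-regular plane graph, a straight-ahead circuit is a closed walk that, at each vertex it passes through, leaves along the edge opposite (i.e. not adjacent in the cyclic order of the four edges at that vertex) to the edge by which it entered; the edge set decomposes uniquely into such circuits. A knot graph is a connected $4$-regular plane graph having exactly one straight-ahead circuit (i.e. the whole graph can be traversed in this way), so that it is the shadow of a one-component link (a knot). Vertices are also called nodes or crossings. *)

theory Defs
  imports "HOL-Analysis.Analysis"
begin

text \<open>
  The plane is the type \<^typ>\<open>complex\<close>. A plane (multi)graph is a finite set \<open>V\<close> of points together
  with a finite set \<open>E\<close> of parametrised edges. Loops are allowed here (\<^const>\<open>simple_path\<close>, unlike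
  \<^const>\<open>arc\<close>, admits closed curves), and so are parallel edges.
\<close>

definition plane_graph :: "complex set \<Rightarrow> (real \<Rightarrow> complex) set \<Rightarrow> bool" where
  "plane_graph V E \<longleftrightarrow>
     finite V \<and> finite E \<and>
     (\<forall>g\<in>E. simple_path g \<and> pathstart g \<in> V \<and> pathfinish g \<in> V \<and> g ` {0<..<1} \<inter> V = {}) \<and>
     disjoint_family_on (\<lambda>g. g ` {0<..<1}) E"

text \<open>
  A dart is an edge with a chosen direction. Edges of a plane graph have disjoint interiors, so
  each of them gives two distinct darts, and a loop contributes two darts at its vertex.
\<close>

definition darts :: "(real \<Rightarrow> complex) set \<Rightarrow> (real \<Rightarrow> complex) set" where
  "darts E = E \<union> reversepath ` E"

definition darts_at :: "(real \<Rightarrow> complex) set \<Rightarrow> complex \<Rightarrow> (real \<Rightarrow> complex) set" where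
  "darts_at E v = {d \<in> darts E. pathstart d = v}"

definition four_regular :: "complex set \<Rightarrow> (real \<Rightarrow> complex) set \<Rightarrow> bool" where
  "four_regular V E \<longleftrightarrow> (\<forall>v\<in>V. card (darts_at E v) = 4)"

definition connected_graph :: "complex set \<Rightarrow> (real \<Rightarrow> complex) set \<Rightarrow> bool" where
  "connected_graph V E \<longleftrightarrow>
     (\<forall>u\<in>V. \<forall>w\<in>V. (u, w) \<in> {(pathstart d, pathfinish d) | d. d \<in> darts E}\<^sup>*)"

text \<open>
  The cyclic order of the darts at a vertex \<open>v\<close> is the counterclockwise order in which they first
  meet a circle about \<open>v\<close>; it is the same for all sufficiently small radii. The infimum below is
  attained whenever the dart \<open>d\<close> meets the circle of radius \<open>r\<close> about its starting point.
\<close>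

definition exit_point :: "real \<Rightarrow> (real \<Rightarrow> complex) \<Rightarrow> complex" where
  "exit_point r d = d (Inf {t \<in> {0..1}. dist (pathstart d) (d t) = r})"

definition ccw_angle :: "real \<Rightarrow> (real \<Rightarrow> complex) \<Rightarrow> (real \<Rightarrow> complex) \<Rightarrow> real" where
  "ccw_angle r d d' =
     Arg2pi ((exit_point r d' - pathstart d') / (exit_point r d - pathstart d))"

definition ccw_next :: "(real \<Rightarrow> complex) set \<Rightarrow> (real \<Rightarrow> complex) \<Rightarrow> (real \<Rightarrow> complex) \<Rightarrow> bool" where
  "ccw_next E d d' \<longleftrightarrow>
     d' \<in> darts_at E (pathstart d) - {d} \<and>
     (\<forall>\<^sub>F r in at_right 0. \<forall>d''\<in>darts_at E (pathstart d) - {d}. ccw_angle r d d' \<le> ccw_angle r d d'')"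

definition opposite :: "(real \<Rightarrow> complex) set \<Rightarrow> (real \<Rightarrow> complex) \<Rightarrow> (real \<Rightarrow> complex) \<Rightarrow> bool" where
  "opposite E d d' \<longleftrightarrow>
     d \<in> darts E \<and> d' \<in> darts_at E (pathstart d) - {d} \<and> \<not> ccw_next E d d' \<and> \<not> ccw_next E d' d"

text \<open>
  A walk that has traversed \<open>d\<close> arrives at its end vertex along \<^term>\<open>reversepath d\<close>, seen from
  that vertex.
\<close>

definition straight_ahead :: "(real \<Rightarrow> complex) set \<Rightarrow> (real \<Rightarrow> complex) \<Rightarrow> (real \<Rightarrow> complex) \<Rightarrow> bool" where
  "straight_ahead E d d' \<longleftrightarrow> opposite E (reversepath d) d'"

definition straight_ahead_walk :: "(real \<Rightarrow> complex) set \<Rightarrow> (real \<Rightarrow> complex) list \<Rightarrow> bool" where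
  "straight_ahead_walk E ds \<longleftrightarrow>
     ds \<noteq> [] \<and> set ds \<subseteq> darts E \<and> distinct (map path_image ds) \<and>
     (\<forall>i<length ds. straight_ahead E (ds ! i) (ds ! (Suc i mod length ds)))"

text \<open>
  Closed straight-ahead walks that differ only in starting point or direction are the same circuit,
  so a circuit is represented by the set of edges (as point sets) that it traverses.
\<close>

definition straight_ahead_circuits :: "(real \<Rightarrow> complex) set \<Rightarrow> complex set set set" where
  "straight_ahead_circuits E = {path_image ` set ds | ds. straight_ahead_walk E ds}"

definition knot_graph :: "complex set \<Rightarrow> (real \<Rightarrow> complex) set \<Rightarrow> bool" where
  "knot_graph V E \<longleftrightarrow>
     plane_graph V E \<and> connected_graph V E \<and> four_regular V E \<and>
     (\<exists>!C. C \<in> straight_ahead_circuits E)"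

definition lune_free_graph :: "complex set \<Rightarrow> (real \<Rightarrow> complex) set \<Rightarrow> bool" where
  "lune_free_graph V E \<longleftrightarrow>
     plane_graph V E \<and> connected_graph V E \<and> four_regular V E \<and>
     (\<forall>g\<in>E. pathstart g \<noteq> pathfinish g) \<and>
     (\<forall>g\<in>E. \<forall>h\<in>E. {pathstart g, pathfinish g} = {pathstart h, pathfinish h} \<longrightarrow> g = h)"

end

theory Submission
  imports Defs
begin

text \<open>Straight edges do more than simplify the drawing. Two segments with the same ends
  overlap, so disjointness of open edges already excludes lunes, and the splice needs no separate
  argument for this. The definition of the cyclic order, by first exits from small circles and their
  arguments, reduces for straight darts to signs of cross products. These signs are decidable for
  integer points, and they do not change under a similarity or when a neighbour slides along its
  ray. The splice is built around this: both new edges lie on the old edge, so every old vertex and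
  every block vertex sees its four neighbours in unchanged directions, and no crossing has to be
  examined again. It is the surrounding curve that is enlarged until the block fits, so the block
  keeps its integer coordinates.\<close>

text \<open>
  A knot shadow with straight edges is recorded as the cyclic list of the points that its single
  closed curve visits, each vertex twice; connectedness and the existence of a circuit through all
  edges are then automatic, and the circuit is unique because every dart has only one straight-ahead
  successor. Explicit integer lists settle \<open>v = 8, \<dots>, 15\<close>. For the step from \<open>v\<close> to \<open>v + 8\<close>, an edge of
  an 8-vertex lune-free knot shadow is cut open, and a tiny copy of the result is spliced into the
  middle of an edge (a connected sum): this keeps the curve connected and creates no parallel edges.
\<close>

subsection \<open>Consecutive pairs in lists\<close>

definition consec :: "'a list \<Rightarrow> ('a \<times> 'a) list" where
  "consec xs = zip xs (tl xs)"

text \<open>Applied to the corners of a closed polygon it lists the directed edges; applied again it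
  lists the pairs of successive edges, one for each passage through a vertex.\<close>

definition cyc :: "'a list \<Rightarrow> ('a \<times> 'a) list" where
  "cyc xs = consec (xs @ [hd xs])"

lemma consec_Nil [simp]: "consec [] = []"
  and consec_single [simp]: "consec [x] = []"
  and consec_Cons2 [simp]: "consec (x # y # xs) = (x, y) # consec (y # xs)"
  by (simp_all add: consec_def)

lemma consec_append:
  assumes "xs \<noteq> []" "ys \<noteq> []"
  shows "consec (xs @ ys) = consec xs @ (last xs, hd ys) # consec ys"
  using assms(1)
proof (induction xs rule: list_nonempty_induct)
  case (single x)
  then show ?case using assms(2) by (cases ys) auto
next
  case (cons x xs)
  then show ?case by (cases xs) auto
qed

lemma consec_map: "consec (map f xs) = map (map_prod f f) (consec xs)"
  by (simp only: consec_def map_tl[symmetric] zip_map_map map_prod_def)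

lemma cyc_map: "xs \<noteq> [] \<Longrightarrow> cyc (map f xs) = map (map_prod f f) (cyc xs)"
  using consec_map[of f "xs @ [hd xs]"] by (simp add: cyc_def hd_map)

lemma length_cyc [simp]: "length (cyc xs) = length xs"
  by (simp add: cyc_def consec_def)

lemma cyc_eq_Nil_iff [simp]: "cyc xs = [] \<longleftrightarrow> xs = []"
  by (metis length_0_conv length_cyc)

lemma consec_nth: "Suc i < length xs \<Longrightarrow> consec xs ! i = (xs ! i, xs ! Suc i)"
  by (simp add: consec_def nth_tl)

lemma cyc_nth:
  assumes "i < length xs"
  shows "cyc xs ! i = (xs ! i, xs ! (Suc i mod length xs))"
proof (cases "Suc i = length xs")
  case True
  then have "xs \<noteq> []" "(xs @ [hd xs]) ! Suc i = hd xs" by (auto simp: nth_append)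
  with True assms show ?thesis
    by (simp add: cyc_def consec_nth hd_conv_nth) (simp add: nth_append)
next
  case False
  with assms have "Suc i < length xs" by simp
  then show ?thesis by (simp add: cyc_def consec_nth nth_append)
qed

lemma consec_set:
  assumes "(x, y) \<in> set (consec xs)"
  shows "x \<in> set xs" "y \<in> set xs"
  using assms by (auto simp: consec_def dest: set_zip_leftD set_zip_rightD list.set_sel(2)[rotated])
    (metis list.sel(2) list.set_sel(2) set_zip_rightD)

lemma cyc_set:
  assumes "(x, y) \<in> set (cyc xs)"
  shows "x \<in> set xs" "y \<in> set xs"
proof -
  have "xs \<noteq> []" using assms by (auto simp: cyc_def)
  then show "x \<in> set xs" "y \<in> set xs"
    using consec_set[of x y "xs @ [hd xs]"] assms by (auto simp: cyc_def)
qed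

lemma cyc_next:
  assumes "x \<in> set xs"
  obtains y where "(x, y) \<in> set (cyc xs)"
  using assms cyc_nth by (metis in_set_conv_nth length_cyc)

lemma cyc_prev:
  assumes "y \<in> set xs"
  obtains x where "(x, y) \<in> set (cyc xs)"
proof -
  obtain j where j: "j < length xs" "xs ! j = y" using assms by (metis in_set_conv_nth)
  define i where "i = (if j = 0 then length xs - 1 else j - 1)"
  have i: "i < length xs" "Suc i mod length xs = j"
    using j by (auto simp: i_def)
  then have "cyc xs ! i = (xs ! i, y)" using cyc_nth[OF i(1)] j by simp
  then show ?thesis using that i(1) by (metis length_cyc nth_mem)
qed

lemma turns_snd_fst:
  assumes "(e, f) \<in> set (cyc (cyc xs))"
  shows "snd e = fst f"
proof -
  obtain i where i: "i < length xs" "cyc (cyc xs) ! i = (e, f)"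
    using assms by (metis in_set_conv_nth length_cyc)
  then have "e = cyc xs ! i" "f = cyc xs ! (Suc i mod length xs)"
    using cyc_nth[of i "cyc xs"] by auto
  moreover have "Suc i mod length xs < length xs" using i by (auto intro: mod_less_divisor)
  ultimately show ?thesis using i(1) by (simp add: cyc_nth)
qed

subsection \<open>Cyclic order of straight darts\<close>

text \<open>
  If \<open>a\<close>, \<open>b\<close>, \<open>c\<close> are the signed areas spanned by the consecutive pairs of three rays from a point,
  then two of them are positive iff the rays are distinct and in counterclockwise order.
\<close>

definition cyclic3 :: "'r::linordered_idom \<Rightarrow> 'r \<Rightarrow> 'r \<Rightarrow> bool" where
  "cyclic3 a b c \<longleftrightarrow> 0 < a \<and> 0 < b \<or> 0 < b \<and> 0 < c \<or> 0 < c \<and> 0 < a"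

text \<open>Four rays in counterclockwise order, expressed by all four of their triples, so that a
  rotation merely permutes the conjuncts. The value ring is left open because the real
  \<open>area\<close> and the computable \<open>area_int\<close> are both used.\<close>

definition around :: "('p \<Rightarrow> 'p \<Rightarrow> 'r::linordered_idom) \<Rightarrow> 'p \<Rightarrow> 'p \<Rightarrow> 'p \<Rightarrow> 'p \<Rightarrow> bool" where
  "around f a b c d \<longleftrightarrow>
     cyclic3 (f a b) (f b c) (f c a) \<and> cyclic3 (f b c) (f c d) (f d b) \<and>
     cyclic3 (f c d) (f d a) (f a c) \<and> cyclic3 (f d a) (f a b) (f b d)"

lemma around_rotate: "around f a b c d \<Longrightarrow> around f b c d a"
  by (simp add: around_def)

text \<open>The cross product of \<open>q - p\<close> and \<open>r - p\<close>, twice the signed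
  area of the triangle. It is positive iff a counterclockwise turn by less than a half turn leads
  from the ray towards \<open>q\<close> to the ray towards \<open>r\<close>.\<close>

definition area :: "complex \<Rightarrow> complex \<Rightarrow> complex \<Rightarrow> real" where
  "area p q r = Im (cnj (q - p) * (r - p))"

lemma area_self [simp]: "area p p r = 0" "area p q p = 0" "area p q q = 0"
  by (simp_all add: area_def algebra_simps)

lemma Im_divide_area: "Im ((y - v) / (x - v)) = area v x y / (cmod (x - v))\<^sup>2"
  by (simp add: complex_div_cnj[of "y - v"] area_def mult.commute)

text \<open>Measure angles from the ray to \<open>x\<close> and suppose that \<open>y\<close> does
  not come before \<open>z\<close>. Then the three areas, where positive, force respectively the
  angle of \<open>y\<close> below pi, the difference of the two angles above pi, and the angle of
  \<open>z\<close> above pi. Any two of these are contradictory within the range from 0 to 2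
  pi.\<close>

lemma Arg2pi_less_if_cyclic3:
  assumes "cyclic3 (area v x y) (area v y z) (area v z x)"
  shows "Arg2pi ((y - v) / (x - v)) < Arg2pi ((z - v) / (x - v))"
proof (rule ccontr)
  assume not_less: "\<not> ?thesis"
  have nz: "x \<noteq> v" "y \<noteq> v" "z \<noteq> v" using assms by (auto simp: cyclic3_def)
  let ?Y = "(y - v) / (x - v)" and ?Z = "(z - v) / (x - v)"
  have "Arg2pi (?Y / ?Z) = Arg2pi ?Y - Arg2pi ?Z"
    using nz not_less by (intro Arg2pi_divide) auto
  also have "?Y / ?Z = (y - v) / (z - v)" using nz by simp
  finally have *: "Arg2pi ((y - v) / (z - v)) = Arg2pi ?Y - Arg2pi ?Z" .
  have Im_pos: "0 < Im ((b - v) / (a - v)) \<longleftrightarrow> 0 < area v a b" if "a \<noteq> v" for a b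
    using that by (simp add: Im_divide_area zero_less_divide_iff)
  have area_minus: "area v b a = - area v a b" for a b
    by (simp add: area_def algebra_simps)
  have Im_neg: "Im ((b - v) / (a - v)) < 0 \<longleftrightarrow> 0 < area v b a" if "a \<noteq> v" for a b
    using that by (simp add: Im_divide_area divide_less_0_iff area_minus[of b a])
  have Y: "0 < area v x y \<Longrightarrow> Arg2pi ?Y < pi"
    using Arg2pi_lt_pi[of ?Y] Im_pos[of x y] nz by auto
  have Z: "0 < area v z x \<Longrightarrow> pi < Arg2pi ?Z"
    using Arg2pi_le_pi[of ?Z] Im_neg[of x z] nz by auto
  have YZ: "0 < area v y z \<Longrightarrow> pi < Arg2pi ?Y - Arg2pi ?Z"
    using Arg2pi_le_pi[of "(y - v) / (z - v)"] Im_neg[of z y] nz * by auto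
  show False
    using assms not_less Y Z YZ Arg2pi_ge_0[of ?Z] Arg2pi_lt_2pi[of ?Y] pi_gt_zero
    unfolding cyclic3_def by (smt (verit))
qed

lemma linepath_eq_iff [simp]: "linepath a b = linepath c d \<longleftrightarrow> a = c \<and> b = d"
  by (metis pathfinish_linepath pathstart_linepath)

text \<open>A straight dart meets the circle at a single parameter, so the infimum is taken over a
  singleton.\<close>

lemma exit_point_linepath:
  assumes "0 < r" "r \<le> dist a b"
  shows "exit_point r (linepath a b) = a + (r / dist a b) *\<^sub>R (b - a)"
proof -
  have ab: "0 < dist a b" using assms by linarith
  have "dist a (linepath a b t) = \<bar>t\<bar> * dist a b" for t
  proof -
    have "linepath a b t - a = t *\<^sub>R (b - a)" by (simp add: linepath_def algebra_simps)
    then show ?thesis by (metis dist_commute dist_norm norm_scaleR)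
  qed
  then have "{t \<in> {0..1}. dist (pathstart (linepath a b)) (linepath a b t) = r} = {r / dist a b}"
    using assms ab by (auto simp: field_simps)
  then show ?thesis by (simp add: exit_point_def linepath_def algebra_simps)
qed

lemma ccw_angle_linepath:
  assumes "0 < r" "r \<le> dist v x" "r \<le> dist v y"
  shows "ccw_angle r (linepath v x) (linepath v y) = Arg2pi ((y - v) / (x - v))"
proof -
  let ?c = "dist v x / dist v y"
  have pos: "0 < dist v x" "0 < dist v y" using assms by linarith+
  have "ccw_angle r (linepath v x) (linepath v y)
      = Arg2pi (((r / dist v y) *\<^sub>R (y - v)) / ((r / dist v x) *\<^sub>R (x - v)))"
    using assms by (simp add: ccw_angle_def exit_point_linepath)
  also have "((r / dist v y) *\<^sub>R (y - v)) / ((r / dist v x) *\<^sub>R (x - v))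
      = of_real ?c * ((y - v) / (x - v))"
    using assms(1) pos by (simp add: scaleR_conv_of_real)
  finally show ?thesis using pos by (metis Arg2pi_times_of_real divide_pos_pos)
qed

text \<open>Once the radius is below the distance to every neighbour, the angles no longer depend on
  it, and the condition on small radii becomes a fixed comparison of arguments.\<close>

lemma ccw_next_linepath:
  assumes E: "darts_at E v = linepath v ` N" and N: "finite N" "v \<notin> N" and x: "x \<in> N"
  shows "ccw_next E (linepath v x) (linepath v y) \<longleftrightarrow>
    y \<in> N \<and> y \<noteq> x \<and> (\<forall>z\<in>N - {x}. Arg2pi ((y - v) / (x - v)) \<le> Arg2pi ((z - v) / (x - v)))"
    (is "_ \<longleftrightarrow> y \<in> N \<and> y \<noteq> x \<and> ?least")
proof (cases "y \<in> N \<and> y \<noteq> x")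
  case True
  have "\<forall>\<^sub>F r in at_right 0. r \<le> dist v z" if "z \<in> N" for z
    using that N(2) eventually_at_right_less[of "0::real"]
    by (auto simp: eventually_at_right_field intro!: exI[of _ "dist v z"])
  then have "\<forall>\<^sub>F r in at_right 0. \<forall>z\<in>N. r \<le> dist v z"
    using N(1) by (simp add: eventually_ball_finite)
  then have "\<forall>\<^sub>F r in at_right 0. 0 < r \<and> (\<forall>z\<in>N. r \<le> dist v z)"
    using eventually_at_right_less[of "0::real"] by eventually_elim auto
  then have "\<forall>\<^sub>F r in at_right 0.
      (\<forall>z\<in>N - {x}. ccw_angle r (linepath v x) (linepath v y)
        \<le> ccw_angle r (linepath v x) (linepath v z)) \<longleftrightarrow> ?least"
    by eventually_elim (use x True in \<open>auto simp: ccw_angle_linepath\<close>)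
  then have "(\<forall>\<^sub>F r in at_right 0.
      \<forall>z\<in>N - {x}. ccw_angle r (linepath v x) (linepath v y)
        \<le> ccw_angle r (linepath v x) (linepath v z)) \<longleftrightarrow> (\<forall>\<^sub>F r in at_right (0::real). ?least)"
    by (rule eventually_cong) simp
  moreover have "linepath v ` N - {linepath v x} = linepath v ` (N - {x})" by auto
  ultimately show ?thesis using True by (simp add: ccw_next_def E eventually_const)
qed (auto simp: ccw_next_def E)

lemma around_Arg2pi:
  assumes "around (area v) a b c d"
  shows "Arg2pi ((b - v) / (a - v)) < Arg2pi ((c - v) / (a - v))"
    and "Arg2pi ((c - v) / (a - v)) < Arg2pi ((d - v) / (a - v))"
proof -
  have "cyclic3 (area v a c) (area v c d) (area v d a)"
    using assms by (auto simp: around_def cyclic3_def)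
  then show "Arg2pi ((c - v) / (a - v)) < Arg2pi ((d - v) / (a - v))"
    by (rule Arg2pi_less_if_cyclic3)
qed (use assms in \<open>auto simp: around_def intro: Arg2pi_less_if_cyclic3\<close>)

lemma around_distinct:
  assumes "around (area v) a b c d"
  shows "v \<notin> {a, b, c, d}" "distinct [a, b, c, d]"
proof -
  show "distinct [a, b, c, d]"
    using around_Arg2pi[OF assms] around_Arg2pi[OF assms[THEN around_rotate]]
      around_Arg2pi[OF assms[THEN around_rotate, THEN around_rotate]] by auto
  show "v \<notin> {a, b, c, d}"
    using assms by (auto simp: around_def cyclic3_def)
qed

text \<open>\<open>b\<close> is the counterclockwise successor of \<open>a\<close> and
  \<open>a\<close> that of \<open>d\<close>; only \<open>c\<close> is related to \<open>a\<close> in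
  neither direction.\<close>

lemma opposite_linepath:
  assumes E: "darts_at E v = linepath v ` {a, b, c, d}" and around: "around (area v) a b c d"
  shows "opposite E (linepath v a) \<delta> \<longleftrightarrow> \<delta> = linepath v c"
proof -
  note r1 = around_rotate[OF around]
  note r2 = around_rotate[OF r1]
  note r3 = around_rotate[OF r2]
  note less = around_Arg2pi[OF around] around_Arg2pi[OF r1] around_Arg2pi[OF r2] around_Arg2pi[OF r3]
  note dist = around_distinct[OF around]
  have nxt: "ccw_next E (linepath v x) (linepath v y) \<longleftrightarrow> y \<in> {a, b, c, d} \<and> y \<noteq> x \<and>
      (\<forall>z\<in>{a, b, c, d} - {x}. Arg2pi ((y - v) / (x - v)) \<le> Arg2pi ((z - v) / (x - v)))"
    if "x \<in> {a, b, c, d}" for x y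
    by (rule ccw_next_linepath[OF E]) (use dist that in auto)
  have "linepath v a \<in> darts E" using E by (auto simp: darts_at_def)
  moreover have "\<not> ccw_next E (linepath v a) (linepath v c)" "\<not> ccw_next E (linepath v c) (linepath v a)"
    using less dist by (auto simp: nxt not_le)
  moreover have "ccw_next E (linepath v a) (linepath v b)" "ccw_next E (linepath v d) (linepath v a)"
    using less dist by (auto simp: nxt)
  ultimately show ?thesis
    using dist by (auto simp: opposite_def E)
qed

subsection \<open>Knot graphs from closed polygonal curves\<close>

text \<open>\<open>sorted_wrt\<close> compares positions rather than members. As open edges are
  nonempty, it therefore also forbids traversing the same edge twice.\<close>

definition plane_segments :: "complex set \<Rightarrow> (complex \<times> complex) list \<Rightarrow> bool" where
  "plane_segments V es \<longleftrightarrow>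
     (\<forall>(a, b)\<in>set es. a \<noteq> b \<and> open_segment a b \<inter> V = {}) \<and>
     sorted_wrt (\<lambda>e f. open_segment (fst e) (snd e) \<inter> open_segment (fst f) (snd f) = {}) es"

text \<open>
  A turn \<open>((x, v), (v, y))\<close> is a passage of the curve through \<open>v\<close>, coming from \<open>x\<close> and leaving to \<open>y\<close>.
  The cyclic order \<open>x\<close>, \<open>x'\<close>, \<open>y\<close>, \<open>y'\<close> says that the two passages cross; the opposite orientation is
  covered by exchanging them.
\<close>

definition crossings ::
  "('p \<Rightarrow> 'p \<Rightarrow> 'p \<Rightarrow> 'r::linordered_idom) \<Rightarrow> 'p set \<Rightarrow> (('p \<times> 'p) \<times> ('p \<times> 'p)) set \<Rightarrow> bool" where
  "crossings ar V T \<longleftrightarrow> (\<forall>v\<in>V. \<exists>x y x' y'.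
     {t \<in> T. fst (snd t) = v} = {((x, v), (v, y)), ((x', v), (v, y'))} \<and> around (ar v) x x' y y')"

definition knot_curve :: "complex list \<Rightarrow> bool" where
  "knot_curve ps \<longleftrightarrow> plane_segments (set ps) (cyc ps) \<and> crossings area (set ps) (set (cyc (cyc ps)))"

lemma plane_segments_distinct:
  assumes "plane_segments V es"
  shows "distinct es"
  using assms by (induction es) (auto simp: plane_segments_def)

lemma plane_segments_disjoint:
  assumes "plane_segments V es" "(a, b) \<in> set es" "(c, d) \<in> set es" "(a, b) \<noteq> (c, d)"
  shows "open_segment a b \<inter> open_segment c d = {}"
proof -
  have *: "\<And>i j. i < j \<Longrightarrow> j < length es \<Longrightarrow>
      open_segment (fst (es ! i)) (snd (es ! i)) \<inter> open_segment (fst (es ! j)) (snd (es ! j)) = {}"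
    using assms(1) by (auto simp: plane_segments_def sorted_wrt_iff_nth_less case_prod_beta)
  obtain i j where "i < length es" "es ! i = (a, b)" "j < length es" "es ! j = (c, d)"
    using assms(2,3) by (metis in_set_conv_nth)
  then show ?thesis using *[of i j] *[of j i] assms(4) by (cases i j rule: linorder_cases) auto
qed

text \<open>The source of lune-freeness: segments with the same two ends have the same nonempty
  interior, so they cannot be different members of a disjoint family. In particular the curve never
  runs back along an edge.\<close>

lemma plane_segments_endpoints_eq:
  assumes "plane_segments V es" "(a, b) \<in> set es" "(c, d) \<in> set es" "{a, b} = {c, d}"
  shows "(a, b) = (c, d)"
proof (rule ccontr)
  assume "(a, b) \<noteq> (c, d)"
  then have "open_segment a b \<inter> open_segment c d = {}"
    by (rule plane_segments_disjoint[OF assms(1-3)])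
  moreover have "open_segment a b = open_segment c d"
    using assms(4) open_segment_commute[of a b] unfolding doubleton_eq_iff by metis
  moreover have "a \<noteq> b" using assms(1,2) by (auto simp: plane_segments_def)
  ultimately show False by simp
qed

section \<open>The plane graph drawn by a closed polygon\<close>

definition segment_paths :: "complex list \<Rightarrow> (real \<Rightarrow> complex) set" where
  "segment_paths ps = (\<lambda>(a, b). linepath a b) ` set (cyc ps)"

lemma linepath_image_open: "a \<noteq> b \<Longrightarrow> linepath a b ` {0<..<1} = open_segment a b"
  by (simp add: open_segment_image_interval linepath_def[abs_def])

lemma darts_segment_paths:
  "darts (segment_paths ps) = {linepath a b |a b. (a, b) \<in> set (cyc ps) \<or> (b, a) \<in> set (cyc ps)}"
proof -
  have "reversepath (case e of (a, b) \<Rightarrow> linepath a b) = (case e of (a, b) \<Rightarrow> linepath b a)"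
    for e :: "complex \<times> complex"
    by (cases e) simp
  then show ?thesis
    unfolding darts_def segment_paths_def image_image
    by (intro set_eqI) (simp add: image_iff Bex_def split_paired_Ex, blast)
qed

lemma darts_at_segment_paths:
  "darts_at (segment_paths ps) v = linepath v ` {w. (v, w) \<in> set (cyc ps) \<or> (w, v) \<in> set (cyc ps)}"
  by (auto simp: darts_at_def darts_segment_paths)

text \<open>On a closed curve every edge leaving \<open>v\<close> has a predecessor and every edge
  entering \<open>v\<close> has a successor, so the two turns at \<open>v\<close> account for all
  darts there.\<close>

lemma knot_curve_vertex:
  assumes "knot_curve ps" "v \<in> set ps"
  obtains x y x' y' where
    "{t \<in> set (cyc (cyc ps)). fst (snd t) = v} = {((x, v), (v, y)), ((x', v), (v, y'))}"
    "around (area v) x x' y y'"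
    "darts_at (segment_paths ps) v = linepath v ` {x, x', y, y'}"
proof -
  have "crossings area (set ps) (set (cyc (cyc ps)))" using assms(1) by (simp add: knot_curve_def)
  from this[unfolded crossings_def, rule_format, OF assms(2)] obtain x y x' y' where *:
    "{t \<in> set (cyc (cyc ps)). fst (snd t) = v} = {((x, v), (v, y)), ((x', v), (v, y'))}"
    "around (area v) x x' y y'"
    by (elim exE conjE) (rule that)
  have turn: "(e, (v, w)) \<in> set (cyc (cyc ps)) \<longleftrightarrow> e = (x, v) \<and> w = y \<or> e = (x', v) \<and> w = y'"
    for e w
  proof -
    have "(e, (v, w)) \<in> {t \<in> set (cyc (cyc ps)). fst (snd t) = v} \<longleftrightarrow>
        (e, (v, w)) \<in> {((x, v), (v, y)), ((x', v), (v, y'))}"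
      unfolding *(1) ..
    then show ?thesis by simp
  qed
  have "(v, w) \<in> set (cyc ps) \<longleftrightarrow> w \<in> {y, y'}" for w
  proof
    assume "(v, w) \<in> set (cyc ps)"
    then obtain e where "(e, (v, w)) \<in> set (cyc (cyc ps))" by (rule cyc_prev)
    then show "w \<in> {y, y'}" by (auto simp: turn)
  next
    assume "w \<in> {y, y'}"
    then obtain e where "(e, (v, w)) \<in> set (cyc (cyc ps))" using turn by blast
    then show "(v, w) \<in> set (cyc ps)" by (rule cyc_set)
  qed
  moreover have "(w, v) \<in> set (cyc ps) \<longleftrightarrow> w \<in> {x, x'}" for w
  proof
    assume "(w, v) \<in> set (cyc ps)"
    then obtain f where f: "((w, v), f) \<in> set (cyc (cyc ps))" by (rule cyc_next)
    then obtain z where "f = (v, z)" using turns_snd_fst by (metis prod.collapse snd_conv)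
    with f show "w \<in> {x, x'}" by (auto simp: turn)
  next
    assume "w \<in> {x, x'}"
    then obtain f where "((w, v), f) \<in> set (cyc (cyc ps))" using turn by blast
    then show "(w, v) \<in> set (cyc ps)" by (rule cyc_set)
  qed
  ultimately have "{w. (v, w) \<in> set (cyc ps) \<or> (w, v) \<in> set (cyc ps)} = {x, x', y, y'}"
    by auto
  then have "darts_at (segment_paths ps) v = linepath v ` {x, x', y, y'}"
    unfolding darts_at_segment_paths by simp
  with * show ?thesis by (rule that)
qed

text \<open>In the order \<open>x\<close>, \<open>x'\<close>, \<open>y\<close>, \<open>y'\<close>
  the two ends of each passage are two places apart, hence opposite. Rotating the order puts each of
  the four darts in front once, which covers both passages in both directions of travel.\<close>

lemma straight_ahead_segment_paths:
  assumes "knot_curve ps" "((x, v), (v', y)) \<in> set (cyc (cyc ps))"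
  shows "straight_ahead (segment_paths ps) (linepath x v) \<delta> \<longleftrightarrow> \<delta> = linepath v' y"
    and "straight_ahead (segment_paths ps) (linepath y v') \<delta> \<longleftrightarrow> \<delta> = linepath v x"
proof -
  have [simp]: "v' = v" using turns_snd_fst[OF assms(2)] by simp
  have "v \<in> set ps" using cyc_set(2)[OF cyc_set(1)[OF assms(2)]] .
  then obtain a b a' b' where *:
    "{t \<in> set (cyc (cyc ps)). fst (snd t) = v} = {((a, v), (v, b)), ((a', v), (v, b'))}"
    "around (area v) a a' b b'"
    "darts_at (segment_paths ps) v = linepath v ` {a, a', b, b'}"
    by (rule knot_curve_vertex[OF assms(1)])
  note r1 = around_rotate[OF *(2)]
  note r2 = around_rotate[OF r1]
  note r3 = around_rotate[OF r2]
  have "((x, v), (v, y)) \<in> {((a, v), (v, b)), ((a', v), (v, b'))}"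
    unfolding *(1)[symmetric] using assms(2) by simp
  moreover have "opposite (segment_paths ps) (linepath v a) \<delta> \<longleftrightarrow> \<delta> = linepath v b"
    using opposite_linepath[OF *(3,2)] .
  moreover have "opposite (segment_paths ps) (linepath v a') \<delta> \<longleftrightarrow> \<delta> = linepath v b'"
    by (rule opposite_linepath[OF _ r1]) (auto simp: *(3))
  moreover have "opposite (segment_paths ps) (linepath v b) \<delta> \<longleftrightarrow> \<delta> = linepath v a"
    by (rule opposite_linepath[OF _ r2]) (auto simp: *(3))
  moreover have "opposite (segment_paths ps) (linepath v b') \<delta> \<longleftrightarrow> \<delta> = linepath v a'"
    by (rule opposite_linepath[OF _ r3]) (auto simp: *(3))
  ultimately show "straight_ahead (segment_paths ps) (linepath x v) \<delta> \<longleftrightarrow> \<delta> = linepath v' y"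
    and "straight_ahead (segment_paths ps) (linepath y v') \<delta> \<longleftrightarrow> \<delta> = linepath v x"
    by (auto simp: straight_ahead_def)
qed

lemma plane_graph_segment_paths:
  assumes "knot_curve ps"
  shows "plane_graph (set ps) (segment_paths ps)"
proof -
  have segs: "plane_segments (set ps) (cyc ps)" using assms by (simp add: knot_curve_def)
  then have *: "a \<noteq> b" "open_segment a b \<inter> set ps = {}" if "(a, b) \<in> set (cyc ps)" for a b
    using that by (auto simp: plane_segments_def)
  have "linepath a b ` {0<..<1} \<inter> linepath c d ` {0<..<1} = {}"
    if "(a, b) \<in> set (cyc ps)" "(c, d) \<in> set (cyc ps)" "linepath a b \<noteq> linepath c d" for a b c d
    using plane_segments_disjoint[OF segs that(1,2)] that * by (simp add: linepath_image_open)
  then have "disjoint_family_on (\<lambda>g. g ` {0<..<1}) (segment_paths ps)"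
    unfolding disjoint_family_on_def segment_paths_def by fast
  moreover have "simple_path g \<and> pathstart g \<in> set ps \<and> pathfinish g \<in> set ps \<and>
      g ` {0<..<1} \<inter> set ps = {}" if g: "g \<in> segment_paths ps" for g
  proof -
    obtain a b where ab: "(a, b) \<in> set (cyc ps)" "g = linepath a b"
      using g by (auto simp: segment_paths_def)
    with *[OF ab(1)] cyc_set[OF ab(1)] show ?thesis
      by (simp add: linepath_image_open simple_path_linepath)
  qed
  ultimately show ?thesis by (simp add: plane_graph_def segment_paths_def)
qed

lemma four_regular_segment_paths:
  assumes "knot_curve ps"
  shows "four_regular (set ps) (segment_paths ps)"
  unfolding four_regular_def
proof
  fix v assume "v \<in> set ps"
  then obtain x y x' y' where *: "around (area v) x x' y y'"
      "darts_at (segment_paths ps) v = linepath v ` {x, x', y, y'}"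
    by (rule knot_curve_vertex[OF assms])
  have "card (linepath v ` {x, x', y, y'}) = card {x, x', y, y'}"
    by (rule card_image) (simp add: inj_on_def)
  also have "\<dots> = 4" using around_distinct(2)[OF *(1)] by simp
  finally show "card (darts_at (segment_paths ps) v) = 4" using *(2) by simp
qed

lemma connected_graph_segment_paths: "connected_graph (set ps) (segment_paths ps)"
proof -
  let ?R = "{(pathstart d, pathfinish d) | d. d \<in> darts (segment_paths ps)}"
  have R: "(a, b) \<in> ?R \<longleftrightarrow> (a, b) \<in> set (cyc ps) \<or> (b, a) \<in> set (cyc ps)" for a b
    by (auto simp: darts_segment_paths) (metis pathfinish_linepath pathstart_linepath)+
  have "sym ?R" by (rule symI) (use R in blast)
  then have sym: "sym (?R\<^sup>*)" by (rule sym_rtrancl)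
  have reach: "i < length ps \<Longrightarrow> (ps ! 0, ps ! i) \<in> ?R\<^sup>*" for i
  proof (induction i)
    case (Suc i)
    then have "(ps ! i, ps ! Suc i) \<in> set (cyc ps)"
      using cyc_nth[of i ps] nth_mem[of i "cyc ps"] by simp
    then have "(ps ! i, ps ! Suc i) \<in> ?R" using R by blast
    with Suc show ?case by (meson Suc_lessD rtrancl.rtrancl_into_rtrancl)
  qed simp
  show ?thesis
    unfolding connected_graph_def
  proof (intro ballI)
    fix u w assume "u \<in> set ps" "w \<in> set ps"
    then obtain i j where "i < length ps" "u = ps ! i" "j < length ps" "w = ps ! j"
      unfolding in_set_conv_nth by blast
    then have "(u, ps ! 0) \<in> ?R\<^sup>*" "(ps ! 0, w) \<in> ?R\<^sup>*"
      using reach[of i] reach[of j] symD[OF sym] by blast+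
    then show "(u, w) \<in> ?R\<^sup>*" by (rule rtrancl_trans)
  qed
qed

lemma lune_free_segment_paths:
  assumes "knot_curve ps"
  shows "lune_free_graph (set ps) (segment_paths ps)"
proof -
  have segs: "plane_segments (set ps) (cyc ps)" using assms by (simp add: knot_curve_def)
  have "pathstart g \<noteq> pathfinish g" if "g \<in> segment_paths ps" for g
    using that segs by (auto simp: segment_paths_def plane_segments_def)
  moreover have "g = h" if "g \<in> segment_paths ps" "h \<in> segment_paths ps"
      "{pathstart g, pathfinish g} = {pathstart h, pathfinish h}" for g h
    using that plane_segments_endpoints_eq[OF segs] by (fastforce simp: segment_paths_def)
  ultimately show ?thesis
    using assms plane_graph_segment_paths connected_graph_segment_paths four_regular_segment_paths
    by (auto simp: lune_free_graph_def)
qed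

text \<open>A closed walk contains the only possible successor of each of its darts. One dart along
  the curve thus brings in all later edges, one against the curve all earlier edges, and periodic
  indexing makes either of these all edges. So any two circuits have the same edge set.\<close>

lemma straight_ahead_walk_covers:
  assumes curve: "knot_curve ps" and walk: "straight_ahead_walk (segment_paths ps) ds"
  shows "path_image ` set ds = path_image ` segment_paths ps"
proof -
  define n where "n = length ps"
  define D where "D i = cyc ps ! (i mod n)" for i
  have "ds \<noteq> []" and darts: "set ds \<subseteq> darts (segment_paths ps)"
    using walk unfolding straight_ahead_walk_def by blast+
  have closed: "\<delta>' \<in> set ds"
    if "\<delta> \<in> set ds" "\<And>\<gamma>. straight_ahead (segment_paths ps) \<delta> \<gamma> \<Longrightarrow> \<gamma> = \<delta>'" for \<delta> \<delta>'
  proof -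
    obtain i where i: "i < length ds" "ds ! i = \<delta>" using \<open>\<delta> \<in> set ds\<close> by (metis in_set_conv_nth)
    then have "straight_ahead (segment_paths ps) \<delta> (ds ! (Suc i mod length ds))"
      using walk unfolding straight_ahead_walk_def by blast
    then have "ds ! (Suc i mod length ds) = \<delta>'" by (rule that(2))
    then show ?thesis using i(1) by (metis mod_less_divisor gr_implies_not0 neq0_conv nth_mem)
  qed
  obtain a b where "linepath a b \<in> set ds" and ab: "(a, b) \<in> set (cyc ps) \<or> (b, a) \<in> set (cyc ps)"
    using \<open>ds \<noteq> []\<close> darts by (cases ds) (auto simp: darts_segment_paths)
  have "n > 0" using ab by (auto simp: n_def cyc_def)
  have D_turn: "(D i, D (Suc i)) \<in> set (cyc (cyc ps))" for i
  proof -
    have "(D i, D (Suc i)) = cyc (cyc ps) ! (i mod n)"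
      using cyc_nth[of "i mod n" "cyc ps"] \<open>n > 0\<close> by (simp add: D_def n_def mod_Suc_eq)
    then show ?thesis using \<open>n > 0\<close> by (simp add: n_def)
  qed
  have D_all: "\<exists>i. e = D i" if "e \<in> set (cyc ps)" for e
    using that by (auto simp: D_def n_def in_set_conv_nth) (metis mod_less)
  define fwd where "fwd i = linepath (fst (D i)) (snd (D i))" for i
  define bwd where "bwd i = linepath (snd (D i)) (fst (D i))" for i
  have fwd_Suc: "fwd (Suc i) \<in> set ds" if "fwd i \<in> set ds" for i
    using closed[OF that] straight_ahead_segment_paths(1)[OF curve] D_turn[of i]
    by (metis fwd_def prod.collapse)
  have bwd_Suc: "bwd i \<in> set ds" if "bwd (Suc i) \<in> set ds" for i
    using closed[OF that] straight_ahead_segment_paths(2)[OF curve] D_turn[of i]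
    by (metis bwd_def prod.collapse)
  have period: "D (i + n * k) = D i" for i k by (simp add: D_def)
  have cover: "(\<forall>i. fwd i \<in> set ds) \<or> (\<forall>i. bwd i \<in> set ds)"
    using ab
  proof
    assume "(a, b) \<in> set (cyc ps)"
    then obtain i where "D i = (a, b)" using D_all by metis
    then have i: "fwd i \<in> set ds" using \<open>linepath a b \<in> set ds\<close> by (simp add: fwd_def)
    have ge: "fwd (i + j) \<in> set ds" for j
      by (induction j) (use i fwd_Suc in auto)
    have "fwd j \<in> set ds" for j
    proof -
      \<comment> \<open>A shift by \<open>i\<close> full periods moves the index past the starting
        one without changing the edge.\<close>
      have "i \<le> j + n * i" using \<open>n > 0\<close> by (simp add: trans_le_add2)
      then have "fwd (j + n * i) \<in> set ds" using ge by (metis le_add_diff_inverse)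
      then show ?thesis by (simp add: fwd_def period)
    qed
    then show ?thesis by blast
  next
    assume "(b, a) \<in> set (cyc ps)"
    then obtain i where "D i = (b, a)" using D_all by metis
    then have i: "bwd i \<in> set ds" using \<open>linepath a b \<in> set ds\<close> by (simp add: bwd_def)
    have le: "bwd j \<in> set ds \<Longrightarrow> k \<le> j \<Longrightarrow> bwd k \<in> set ds" for j k
      by (induction j) (use bwd_Suc le_Suc_eq in auto)
    have "bwd j \<in> set ds" for j
    proof -
      have "bwd (i + n * j) \<in> set ds" using i by (simp add: bwd_def period)
      moreover have "j \<le> i + n * j" using \<open>n > 0\<close> by (simp add: trans_le_add2)
      ultimately show ?thesis by (rule le)
    qed
    then show ?thesis by blast
  qed
  have image: "path_image (fwd i) = path_image (bwd i)" for i
    by (simp add: fwd_def bwd_def closed_segment_commute)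
  show ?thesis
  proof
    show "path_image ` set ds \<subseteq> path_image ` segment_paths ps"
    proof
      fix C assume "C \<in> path_image ` set ds"
      then obtain d where "d \<in> darts (segment_paths ps)" "C = path_image d" using darts by blast
      then show "C \<in> path_image ` segment_paths ps"
        by (auto simp: darts_def)
    qed
    show "path_image ` segment_paths ps \<subseteq> path_image ` set ds"
    proof
      fix C assume "C \<in> path_image ` segment_paths ps"
      then obtain e where "e \<in> set (cyc ps)" "C = path_image (linepath (fst e) (snd e))"
        by (auto simp: segment_paths_def)
      then obtain i where "C = path_image (fwd i)" using D_all by (metis fwd_def)
      then show "C \<in> path_image ` set ds" using cover image by blast
    qed
  qed
qed

lemma straight_ahead_walk_curve:
  assumes curve: "knot_curve ps" and "ps \<noteq> []"
  shows "straight_ahead_walk (segment_paths ps) (map (\<lambda>(a, b). linepath a b) (cyc ps))"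
proof -
  let ?l = "\<lambda>(a, b). linepath a b :: real \<Rightarrow> complex"
  have segs: "plane_segments (set ps) (cyc ps)" using curve by (simp add: knot_curve_def)
  \<comment> \<open>As a point set a segment determines its ends up to order, and
    \<open>plane_segments_endpoints_eq\<close> settles the order.\<close>
  have "inj_on (path_image \<circ> ?l) (set (cyc ps))"
    using plane_segments_endpoints_eq[OF segs] by (force simp: inj_on_def)
  then have "distinct (map path_image (map ?l (cyc ps)))"
    using plane_segments_distinct[OF segs] by (simp add: distinct_map)
  moreover have "straight_ahead (segment_paths ps) (?l (cyc ps ! i)) (?l (cyc ps ! (Suc i mod length ps)))"
    if "i < length ps" for i
  proof -
    have "(cyc ps ! i, cyc ps ! (Suc i mod length ps)) \<in> set (cyc (cyc ps))"
      using that cyc_nth[of i "cyc ps"] nth_mem[of i "cyc (cyc ps)"] by simp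
    then show ?thesis
      using straight_ahead_segment_paths(1)[OF curve] by (auto split: prod.split)
  qed
  moreover have "?l ` set (cyc ps) \<subseteq> darts (segment_paths ps)"
    by (auto simp: darts_def segment_paths_def)
  ultimately show ?thesis using \<open>ps \<noteq> []\<close> by (simp add: straight_ahead_walk_def)
qed

lemma knot_graph_segment_paths:
  assumes "knot_curve ps" "ps \<noteq> []"
  shows "knot_graph (set ps) (segment_paths ps)"
proof -
  have "straight_ahead_circuits (segment_paths ps) = {path_image ` segment_paths ps}"
    unfolding straight_ahead_circuits_def
    using straight_ahead_walk_covers[OF assms(1)] straight_ahead_walk_curve[OF assms] by blast
  then show ?thesis
    using assms(1) plane_graph_segment_paths connected_graph_segment_paths four_regular_segment_paths
    by (auto simp: knot_graph_def)
qed

subsection \<open>Connected sum with a block\<close>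

lemma around_cong:
  assumes "\<And>x y. 0 < f' (m x) (m y) \<longleftrightarrow> 0 < f x y" "around f a b c d"
  shows "around f' (m a) (m b) (m c) (m d)"
  using assms by (simp add: around_def cyclic3_def)

text \<open>Used for two kinds of maps: similarities of the plane, and the embedding of integer
  points, where the area changes its type as well.\<close>

lemma crossings_image:
  assumes cr: "crossings ar V T" and "inj f"
    and sgn: "\<And>v x y. 0 < ar' (f v) (f x) (f y) \<longleftrightarrow> 0 < ar v x y"
  shows "crossings ar' (f ` V) (map_prod (map_prod f f) (map_prod f f) ` T)"
  unfolding crossings_def
proof
  define g where "g = map_prod (map_prod f f) (map_prod f f)"
  have mid: "fst (snd (g t)) = f (fst (snd t))" for t by (cases t) (auto simp: g_def)
  fix w assume "w \<in> f ` V"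
  then obtain v where v: "v \<in> V" "w = f v" by blast
  from cr[unfolded crossings_def, rule_format, OF v(1)] obtain x y x' y' where
    *: "{t \<in> T. fst (snd t) = v} = {((x, v), (v, y)), ((x', v), (v, y'))}" "around (ar v) x x' y y'"
    by (elim exE conjE) (rule that)
  have "{t \<in> g ` T. fst (snd t) = w} = g ` {t \<in> T. fst (snd t) = v}"
    using \<open>inj f\<close> v(2) by (auto simp: mid inj_eq)
  also have "\<dots> = {((f x, w), (w, f y)), ((f x', w), (w, f y'))}"
    unfolding *(1) by (simp add: v(2) g_def)
  finally have "{t \<in> g ` T. fst (snd t) = w} = {((f x, w), (w, f y)), ((f x', w), (w, f y'))}" .
  moreover have "around (ar' w) (f x) (f x') (f y) (f y')"
    unfolding v(2) using sgn *(2) by (rule around_cong[where m = f])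
  ultimately show "\<exists>x y x' y'. {t \<in> map_prod (map_prod f f) (map_prod f f) ` T. fst (snd t) = w} =
      {((x, w), (w, y)), ((x', w), (w, y'))} \<and> around (ar' w) x x' y y'"
    unfolding g_def by blast
qed

text \<open>Sliding the neighbours of \<open>v\<close> along their rays multiplies each area at
  \<open>v\<close> by a positive factor. The replacement \<open>m v x\<close> depends on
  \<open>v\<close> because the two ends of a cut edge receive different new neighbours.\<close>

lemma crossings_move:
  fixes m :: "complex \<Rightarrow> complex \<Rightarrow> complex"
  defines "g \<equiv> \<lambda>((x, u), (w, y)). ((m u x, u), (w, m w y))"
  assumes cr: "crossings area V T"
    and T': "{t \<in> T'. fst (snd t) \<in> V} = g ` {t \<in> T. fst (snd t) \<in> V}"
    and ray: "\<And>v x. v \<in> V \<Longrightarrow> \<exists>s>0. m v x - v = s *\<^sub>R (x - v)"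
  shows "crossings area V T'"
  unfolding crossings_def
proof
  fix v assume v: "v \<in> V"
  from cr[unfolded crossings_def, rule_format, OF v] obtain x y x' y' where
    *: "{t \<in> T. fst (snd t) = v} = {((x, v), (v, y)), ((x', v), (v, y'))}" "around (area v) x x' y y'"
    by (elim exE conjE) (rule that)
  have mid: "fst (snd (g t)) = fst (snd t)" for t by (simp add: g_def split: prod.split)
  have "{t \<in> T'. fst (snd t) = v} = {t \<in> {t \<in> T'. fst (snd t) \<in> V}. fst (snd t) = v}" using v by blast
  also have "\<dots> = g ` {t \<in> T. fst (snd t) = v}" unfolding T' using v mid by fastforce
  also have "\<dots> = {((m v x, v), (v, m v y)), ((m v x', v), (v, m v y'))}"
    unfolding *(1) by (simp add: g_def)
  finally have "{t \<in> T'. fst (snd t) = v} = {((m v x, v), (v, m v y)), ((m v x', v), (v, m v y'))}" .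
  moreover have "0 < area v (m v x) (m v y) \<longleftrightarrow> 0 < area v x y" for x y
  proof -
    obtain s where s: "0 < s" "m v x - v = s *\<^sub>R (x - v)" using ray[OF v] by blast
    obtain t where t: "0 < t" "m v y - v = t *\<^sub>R (y - v)" using ray[OF v] by blast
    have "area v (m v x) (m v y) = (s * t) * area v x y"
      unfolding area_def s t by (simp add: algebra_simps)
    moreover have "0 < s * t" using s(1) t(1) by simp
    ultimately show ?thesis by (auto simp: zero_less_mult_iff[of "s * t"])
  qed
  then have "around (area v) (m v x) (m v x') (m v y) (m v y')" using *(2) by (rule around_cong)
  ultimately show "\<exists>x y x' y'. {t \<in> T'. fst (snd t) = v} = {((x, v), (v, y)), ((x', v), (v, y'))} \<and>
      around (area v) x x' y y'" by blast
qed

lemma segment_similarity: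
  fixes \<alpha> \<beta> :: complex
  assumes "\<alpha> \<noteq> 0"
  shows "open_segment (\<alpha> * a + \<beta>) (\<alpha> * b + \<beta>) = (\<lambda>z. \<alpha> * z + \<beta>) ` open_segment a b"
    and "closed_segment (\<alpha> * a + \<beta>) (\<alpha> * b + \<beta>) = (\<lambda>z. \<alpha> * z + \<beta>) ` closed_segment a b"
proof -
  have lin: "linear (\<lambda>z. \<alpha> * z)" by (simp add: bounded_linear.linear bounded_linear_mult_right)
  have "inj (\<lambda>z. \<alpha> * z)" using assms by (simp add: inj_on_def)
  then have "open_segment (\<alpha> * a) (\<alpha> * b) = (\<lambda>z. \<alpha> * z) ` open_segment a b"
    using open_segment_linear_image[OF lin] by blast
  then show "open_segment (\<alpha> * a + \<beta>) (\<alpha> * b + \<beta>) = (\<lambda>z. \<alpha> * z + \<beta>) ` open_segment a b"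
    using open_segment_translation[of \<beta> "\<alpha> * a" "\<alpha> * b"] by (simp add: image_image add.commute)
  show "closed_segment (\<alpha> * a + \<beta>) (\<alpha> * b + \<beta>) = (\<lambda>z. \<alpha> * z + \<beta>) ` closed_segment a b"
    using closed_segment_translation[of \<beta> "\<alpha> * a" "\<alpha> * b"] closed_segment_linear_image[OF lin, of a b]
    by (simp add: image_image add.commute)
qed

lemma plane_segments_similarity:
  assumes "plane_segments V es" "\<alpha> \<noteq> 0" and f: "f = (\<lambda>z. \<alpha> * z + \<beta>)"
  shows "plane_segments (f ` V) (map (map_prod f f) es)"
proof -
  have "inj f" using assms(2) by (simp add: f inj_on_def)
  then have im: "f ` A \<inter> f ` B = {} \<longleftrightarrow> A \<inter> B = {}" for A B
    by (metis image_Int image_is_empty)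
  have seg: "open_segment (f a) (f b) = f ` open_segment a b" for a b
    using segment_similarity(1)[OF assms(2)] by (simp add: f)
  show ?thesis
    using assms(1) \<open>inj f\<close>
    by (simp add: plane_segments_def sorted_wrt_map seg im case_prod_beta inj_eq)
qed

text \<open>Multiplication by a complex number scales signed areas by its squared modulus, so
  orientation is kept.\<close>

lemma knot_curve_similarity:
  assumes "knot_curve ps" "ps \<noteq> []" "\<alpha> \<noteq> 0" and f: "f = (\<lambda>z. \<alpha> * z + \<beta>)"
  shows "knot_curve (map f ps)"
proof -
  have "area (f p) (f q) (f r) = (cmod \<alpha>)\<^sup>2 * area p q r" for p q r
  proof -
    have "cnj (f q - f p) * (f r - f p) = (\<alpha> * cnj \<alpha>) * (cnj (q - p) * (r - p))"
      by (simp add: f algebra_simps)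
    then show ?thesis unfolding area_def complex_norm_square[symmetric] by simp
  qed
  then have sgn: "0 < area (f p) (f q) (f r) \<longleftrightarrow> 0 < area p q r" for p q r
    using assms(3) by (simp add: zero_less_mult_iff)
  have "inj f" using assms(3) by (simp add: f inj_on_def)
  then have "crossings area (f ` set ps) (map_prod (map_prod f f) (map_prod f f) ` set (cyc (cyc ps)))"
    using assms(1) sgn by (intro crossings_image[where ar = area]) (auto simp: knot_curve_def)
  moreover have "plane_segments (f ` set ps) (map (map_prod f f) (cyc ps))"
    using assms(1,3) f by (intro plane_segments_similarity) (auto simp: knot_curve_def)
  moreover have "cyc (cyc (map f ps)) = map (map_prod (map_prod f f) (map_prod f f)) (cyc (cyc ps))"
    using assms(2) by (simp add: cyc_map)
  ultimately show ?thesis using assms(2) by (simp add: knot_curve_def cyc_map)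
qed

lemma Collect_mem_Un: "{t \<in> A \<union> B. p t} = {t \<in> A. p t} \<union> {t \<in> B. p t}"
  by blast

lemma hd_consec: "2 \<le> length xs \<Longrightarrow> consec xs \<noteq> [] \<and> fst (hd (consec xs)) = hd xs"
  by (cases xs rule: list.exhaust[case_product list.exhaust]; cases "tl xs") auto

lemma last_consec: "2 \<le> length xs \<Longrightarrow> snd (last (consec xs)) = last xs"
proof (induction xs)
  case (Cons x xs)
  then show ?case by (cases xs; cases "tl xs") (auto simp: consec_def)
qed simp

lemma segment_Re:
  assumes "z \<in> open_segment a b" "Re a < Re b"
  shows "Re a < Re z" "Re z < Re b"
proof -
  obtain u where u: "0 < u" "u < 1" "z = (1 - u) *\<^sub>R a + u *\<^sub>R b"
    using assms(1) by (auto simp: in_segment)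
  from u(3) have "Re z = (1 - u) * Re a + u * Re b" by simp
  then have eqs: "Re z - Re a = u * (Re b - Re a)" "Re b - Re z = (1 - u) * (Re b - Re a)"
    by algebra+
  have "0 < Re z - Re a" "0 < Re b - Re z"
    unfolding eqs using u assms(2) by (intro mult_pos_pos; simp)+
  then show "Re a < Re z" "Re z < Re b" by simp_all
qed

text \<open>
  A block is an open curve that replaces a segment of the real line around the origin. The points
  \<open>\<plusminus>(L + 1)\<close> stand for its neighbours on the line, of which only the direction matters.
\<close>

locale block =
  fixes L R :: real and K :: "complex list"
  assumes L: "0 < L" "L \<le> R"
    and length_K: "2 \<le> length K" and hd_K: "hd K = - of_real L" and last_K: "last K = of_real L"
    and bound: "\<And>z. z \<in> set K \<Longrightarrow> - L \<le> Re z \<and> Re z \<le> L \<and> cmod z \<le> R"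
    and segments_K: "plane_segments (set K) (consec K)"
    and crossings_K: "crossings area (set K)
      (set (consec (consec ([- of_real (L + 1)] @ K @ [of_real (L + 1)]))))"
begin

lemma K_segment:
  assumes "(c, d) \<in> set (consec K)" "z \<in> open_segment c d"
  shows "- L \<le> Re z \<and> Re z \<le> L \<and> cmod z \<le> R"
proof -
  let ?C = "{z. - L \<le> Re z} \<inter> {z. Re z \<le> L} \<inter> cball 0 R"
  have "convex ?C" by (intro convex_Int convex_halfspace_Re_ge convex_halfspace_Re_le convex_cball)
  moreover have "c \<in> ?C" "d \<in> ?C" using consec_set[OF assms(1)] bound by auto
  ultimately have "closed_segment c d \<subseteq> ?C" by (intro closed_segment_subset)
  then show ?thesis using assms(2) by (auto simp: open_segment_def)
qed

section \<open>Splicing the block into a closing edge that runs along the real line\<close>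

context
  fixes N :: real and qs :: "complex list"
  assumes curve: "knot_curve qs" and N: "R < N"
    and length_qs: "2 \<le> length qs" and hd_qs: "hd qs = of_real N" and last_qs: "last qs = - of_real N"
    and far: "\<And>c d. (c, d) \<in> set (consec qs) \<Longrightarrow> closed_segment c d \<inter> cball 0 R = {}"
begin

private abbreviation "a \<equiv> - of_real N :: complex"
private abbreviation "b \<equiv> of_real N :: complex"
private abbreviation "k \<equiv> - of_real L :: complex"
private abbreviation "l \<equiv> of_real L :: complex"

lemma cyc_qs: "cyc qs = consec qs @ [(a, b)]"
proof -
  have "qs \<noteq> []" using length_qs by auto
  then show ?thesis by (simp add: cyc_def consec_append hd_qs last_qs)
qed

lemma cyc_insert: "cyc (qs @ K) = consec qs @ (a, k) # consec K @ [(l, b)]"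
proof -
  have "qs \<noteq> []" "K \<noteq> []" using length_qs length_K by auto
  then show ?thesis
    by (simp add: cyc_def consec_append hd_qs last_qs hd_K last_K)
qed

lemma qs_far: "v \<in> set qs \<Longrightarrow> R < cmod v"
proof -
  assume "v \<in> set qs"
  then obtain e where e: "(v, e) \<in> set (cyc qs)" by (rule cyc_next)
  then consider "v = a" | "(v, e) \<in> set (consec qs)" by (auto simp: cyc_qs)
  then show ?thesis
  proof cases
    case 2
    then show ?thesis using far[OF 2] by (force simp: dist_norm)
  qed (use N L in auto)
qed

lemma disjoint_insert: "set qs \<inter> set K = {}"
  using qs_far bound by fastforce

lemma subsegment:
  "open_segment a k \<subseteq> open_segment a b" "open_segment l b \<subseteq> open_segment a b"
proof -
  have "of_real x \<in> open_segment a b" if "\<bar>x\<bar> < N" for x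
  proof -
    have "of_real x = (1 - (N + x) / (2 * N)) *\<^sub>R a + ((N + x) / (2 * N)) *\<^sub>R b"
      using that by (auto simp: complex_eq_iff field_simps)
    moreover have "0 < (N + x) / (2 * N)" "(N + x) / (2 * N) < 1" using that by (auto simp: field_simps)
    moreover have "a \<noteq> b" using that by auto
    ultimately show ?thesis unfolding in_segment by blast
  qed
  from this[of "- L"] this[of L] have "k \<in> open_segment a b" "l \<in> open_segment a b"
    using N L by auto
  then show "open_segment a k \<subseteq> open_segment a b" "open_segment l b \<subseteq> open_segment a b"
    by (simp_all add: subset_open_segment open_closed_segment)
qed

text \<open>Three regions keep the pieces apart. The block lies in the disc of radius
  \<open>R\<close>, which the remaining old edges avoid. The two new edges lie on the old closing
  edge, hence away from the rest of the old curve, and outside the strip of real parts between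
  \<open>- L\<close> and \<open>L\<close>, hence away from the block and from each other.\<close>

lemma plane_segments_insert: "plane_segments (set (qs @ K)) (cyc (qs @ K))"
proof -
  have old: "plane_segments (set qs) (consec qs @ [(a, b)])"
    using curve by (simp add: knot_curve_def cyc_qs)
  have ak: "Re z < - L" if "z \<in> open_segment a k" for z
    using segment_Re(2)[OF that] N L by simp
  have lb: "L < Re z" if "z \<in> open_segment l b" for z
    using segment_Re(1)[OF that] N L by simp
  have qs: "R < cmod z" if "(c, d) \<in> set (consec qs)" "z \<in> open_segment c d" for c d z
    using far[OF that(1)] that(2) by (auto simp: open_segment_def)
  have "\<forall>e\<in>set (consec qs). open_segment (fst e) (snd e) \<inter> open_segment a b = {}"
    using old by (simp add: plane_segments_def sorted_wrt_append)
  then have qs_ab: "open_segment c d \<inter> open_segment a b = {}" if "(c, d) \<in> set (consec qs)" for c d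
    using that by fastforce
  have ab: "open_segment a b \<inter> set qs = {}"
    using old by (auto simp: plane_segments_def)
  have disjoint: "open_segment c d \<inter> open_segment a k = {}" "open_segment c d \<inter> open_segment l b = {}"
      if "(c, d) \<in> set (consec qs)" for c d
    using qs_ab[OF that] subsegment by blast+
  have disjoint': "open_segment c d \<inter> open_segment c' d' = {}"
      if "(c, d) \<in> set (consec qs)" "(c', d') \<in> set (consec K)" for c d c' d'
    using qs[OF that(1)] K_segment[OF that(2)] by fastforce
  have disjoint'': "open_segment a k \<inter> open_segment c d = {}" "open_segment c d \<inter> open_segment l b = {}"
      if "(c, d) \<in> set (consec K)" for c d
    using K_segment[OF that] ak lb by fastforce+
  have "open_segment a k \<inter> open_segment l b = {}" using ak lb L by fastforce
  then have "sorted_wrt (\<lambda>e f. open_segment (fst e) (snd e) \<inter> open_segment (fst f) (snd f) = {})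
      (cyc (qs @ K))"
    using old segments_K disjoint disjoint' disjoint''
    by (simp add: cyc_insert plane_segments_def sorted_wrt_append)
  moreover have "c \<noteq> d \<and> open_segment c d \<inter> set (qs @ K) = {}" if "(c, d) \<in> set (cyc (qs @ K))" for c d
  proof -
    from that consider "(c, d) \<in> set (consec qs)" | "(c, d) = (a, k)" | "(c, d) \<in> set (consec K)"
      | "(c, d) = (l, b)" by (auto simp: cyc_insert)
    then show ?thesis
    proof cases
      case 1
      then have "c \<noteq> d \<and> open_segment c d \<inter> set qs = {}" using old by (auto simp: plane_segments_def)
      then show ?thesis using qs[OF 1] bound by fastforce
    next
      case 2
      then have "open_segment c d \<inter> set K = {}" using ak bound by fastforce
      then show ?thesis using 2 ab subsegment(1) N L by auto
    next
      case 3
      then have "c \<noteq> d \<and> open_segment c d \<inter> set K = {}" using segments_K by (auto simp: plane_segments_def)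
      then show ?thesis using K_segment[OF 3] qs_far by fastforce
    next
      case 4
      then have "open_segment c d \<inter> set K = {}" using lb bound by fastforce
      then show ?thesis using 4 ab subsegment(2) N L by auto
    qed
  qed
  ultimately show ?thesis by (auto simp: plane_segments_def)
qed

private abbreviation "P \<equiv> consec qs"
private abbreviation "Q \<equiv> consec K"

lemma P_Q_nonempty: "P \<noteq> []" "Q \<noteq> []"
  using hd_consec[OF length_qs] hd_consec[OF length_K] by simp_all

lemma P_ends:
  obtains a' b' where "last P = (a', a)" "hd P = (b, b')"
  by (rule that[of "fst (last P)" "snd (hd P)"])
    (simp_all add: prod_eq_iff hd_consec[OF length_qs] last_consec[OF length_qs] hd_qs last_qs)

lemma Q_ends:
  obtains k' l' where "hd Q = (k, k')" "last Q = (l', l)"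
  by (rule that[of "snd (hd Q)" "fst (last Q)"])
    (simp_all add: prod_eq_iff hd_consec[OF length_K] last_consec[OF length_K] hd_K last_K)

lemma turns_qs: "set (cyc (cyc qs)) = set (consec P) \<union> {(last P, (a, b)), ((a, b), hd P)}"
proof -
  have "P \<noteq> []" using hd_consec[OF length_qs] by simp
  then show ?thesis by (auto simp: cyc_qs cyc_def[of "P @ _"] consec_append)
qed

text \<open>Only the four turns at the two seams are new; the others come unchanged from the old
  curve or from the block.\<close>

lemma turns_insert:
  "set (cyc (cyc (qs @ K))) = set (consec P) \<union> {(last P, (a, k)), ((a, k), hd Q)} \<union>
     set (consec Q) \<union> {(last Q, (l, b)), ((l, b), hd P)}"
proof -
  note ne = P_Q_nonempty
  have "cyc (cyc (qs @ K)) = consec (P @ [(a, k)] @ Q @ [(l, b)] @ [hd P])"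
    using ne by (simp add: cyc_insert cyc_def[of "P @ _"])
  also have "\<dots> = consec P @ (last P, (a, k)) # ((a, k), hd Q) # consec Q @ [(last Q, (l, b)), ((l, b), hd P)]"
    using ne by (simp add: consec_append[of P] consec_append[of "[_]" "Q @ _", simplified] consec_append[of Q])
  finally show ?thesis by auto
qed

lemma turns_K:
  "set (consec (consec ([- of_real (L + 1)] @ K @ [of_real (L + 1)]))) =
     {((- of_real (L + 1), k), hd Q)} \<union> set (consec Q) \<union> {(last Q, (l, of_real (L + 1)))}"
proof -
  have ne: "K \<noteq> []" "Q \<noteq> []" using hd_consec length_K by force+
  have "consec ([- of_real (L + 1)] @ K @ [of_real (L + 1)]) =
      [(- of_real (L + 1), k)] @ Q @ [(l, of_real (L + 1))]"
    using ne consec_append[of "[- of_real (L + 1)]" "K @ [of_real (L + 1)]"]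
      consec_append[of K "[of_real (L + 1)]"] by (simp add: hd_K last_K)
  then show ?thesis
    using ne consec_append[of "[(- of_real (L + 1), k)]" "Q @ [(l, of_real (L + 1))]"]
      consec_append[of Q "[(l, of_real (L + 1))]"] by auto
qed

lemma crossings_insert_qs: "crossings area (set qs) (set (cyc (cyc (qs @ K))))"
proof -
  \<comment> \<open>Seen from \<open>a\<close>, the neighbour \<open>b\<close> is replaced by
    \<open>k\<close>; seen from \<open>b\<close>, the neighbour \<open>a\<close> is replaced by
    \<open>l\<close>.\<close>
  define m where "m v x = (if v = a \<and> x = b then k else if v = b \<and> x = a then l else x)" for v x
  define g where "g = (\<lambda>((x, u), (w, y)). ((m u x, u), (w, m w y)))"
  have ab: "a \<noteq> b" using N L by (auto simp: complex_eq_iff)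
  note ne = P_Q_nonempty
  have old: "plane_segments (set qs) (P @ [(a, b)])"
    using curve by (simp add: knot_curve_def cyc_qs)
  have notin: "(a, b) \<notin> set P"
    using plane_segments_distinct[OF old] by simp
  \<comment> \<open>\<open>m\<close> does not see the direction of travel, so it would also alter an
    edge from \<open>b\<close> to \<open>a\<close>; such an edge would overlap the closing
    edge.\<close>
  have notin': "(b, a) \<notin> set P"
    using plane_segments_endpoints_eq[OF old, of b a a b] ab by auto
  have fixed: "m u x = x" "m x u = u" if "(x, u) \<in> set P" for x u
    using that notin notin' by (auto simp: m_def)
  obtain a' b' where ends: "last P = (a', a)" "hd P = (b, b')" by (rule P_ends)
  have ends_in: "(a', a) \<in> set P" "(b, b') \<in> set P"
    using ne(1) last_in_set[of P] hd_in_set[of P] ends by auto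
  have ends_ne: "a' \<noteq> b" "b' \<noteq> a" using ends_in notin' by auto
  obtain k' l' where ends': "hd Q = (k, k')" "last Q = (l', l)" by (rule Q_ends)
  have k: "k \<notin> set qs" "l \<notin> set qs"
    using disjoint_insert hd_K last_K length_K by (metis disjoint_iff hd_in_set last_in_set list.size(3) not_numeral_le_zero)+
  have a_b: "a \<in> set qs" "b \<in> set qs" using ends_in consec_set by metis+
  have P_turn: "g t = t \<and> fst (snd t) \<in> set qs" if t: "t \<in> set (consec P)" for t
  proof -
    obtain x u w y where xy: "t = ((x, u), (w, y))" by (metis prod.collapse)
    then have "(x, u) \<in> set P" "(w, y) \<in> set P" using t consec_set by metis+
    then show ?thesis using fixed consec_set(1)[of w y qs] by (simp add: xy g_def)
  qed
  have Q_turn: "fst (snd t) \<notin> set qs" if t: "t \<in> set (consec Q)" for t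
  proof -
    obtain e w y where "t = (e, (w, y))" by (metis prod.collapse)
    then show ?thesis using consec_set(1)[of w y K] consec_set(2)[of e "(w, y)" Q] t disjoint_insert by auto
  qed
  have g_ends: "g (last P, (a, b)) = (last P, (a, k))" "g ((a, b), hd P) = ((l, b), hd P)"
    using ab ends_ne by (simp_all add: g_def ends m_def)
  have mids: "{t \<in> set (consec P). fst (snd t) \<in> set qs} = set (consec P)"
      "{t \<in> set (consec Q). fst (snd t) \<in> set qs} = {}" "g ` set (consec P) = set (consec P)"
    using P_turn Q_turn by force+
  have new: "{t \<in> {(last P, (a, k)), ((a, k), hd Q)}. fst (snd t) \<in> set qs} = {(last P, (a, k))}"
      "{t \<in> {(last Q, (l, b)), ((l, b), hd P)}. fst (snd t) \<in> set qs} = {((l, b), hd P)}"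
    using k a_b by (auto simp: ends ends')
  have "{t \<in> set (cyc (cyc (qs @ K))). fst (snd t) \<in> set qs} =
      set (consec P) \<union> {(last P, (a, k)), ((l, b), hd P)}"
    unfolding turns_insert Collect_mem_Un mids new by blast
  also have "\<dots> = g ` (set (consec P) \<union> {(last P, (a, b)), ((a, b), hd P)})"
    by (simp only: image_Un image_insert image_empty mids g_ends)
  also have "{(last P, (a, b)), ((a, b), hd P)} =
      {t \<in> {(last P, (a, b)), ((a, b), hd P)}. fst (snd t) \<in> set qs}"
    using a_b by (auto simp: ends)
  also have "set (consec P) \<union> \<dots> = {t \<in> set (cyc (cyc qs)). fst (snd t) \<in> set qs}"
    unfolding turns_qs Collect_mem_Un mids ..
  finally have turns: "{t \<in> set (cyc (cyc (qs @ K))). fst (snd t) \<in> set qs} =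
      g ` {t \<in> set (cyc (cyc qs)). fst (snd t) \<in> set qs}" .
  have ray: "\<exists>s>0. m v x - v = s *\<^sub>R (x - v)" for v x
  proof -
    \<comment> \<open>Length of each new edge divided by the length of the old closing edge.\<close>
    let ?s = "(N - L) / (2 * N)"
    have pos: "0 < ?s" "0 < N" using N L by auto
    have "k - a = ?s *\<^sub>R (b - a)" "l - b = ?s *\<^sub>R (a - b)"
      using pos(2) by (simp_all add: complex_eq_iff field_simps)
    then have "m a b - a = ?s *\<^sub>R (b - a)" "m b a - b = ?s *\<^sub>R (a - b)"
      using ab by (simp_all only: m_def simp_thms if_True if_False)
    moreover have "m v x - v = 1 *\<^sub>R (x - v)" if "\<not> (v = a \<and> x = b)" "\<not> (v = b \<and> x = a)"
      using that unfolding m_def by (simp only: if_False scaleR_one)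
    ultimately show ?thesis using pos(1) zero_less_one by blast
  qed
  show ?thesis
    by (rule crossings_move[where m = m, folded g_def, OF _ turns ray])
      (use curve in \<open>simp add: knot_curve_def\<close>)
qed

lemma crossings_insert_K: "crossings area (set K) (set (cyc (cyc (qs @ K))))"
proof -
  define a0 b0 :: complex where "a0 = - of_real (L + 1)" and "b0 = of_real (L + 1)"
  \<comment> \<open>Now the stand-ins just outside the block give way to the true neighbours
    \<open>a\<close> and \<open>b\<close>.\<close>
  define m where "m v x = (if v = k \<and> x = a0 then a else if v = l \<and> x = b0 then b else x)" for v x
  define g where "g = (\<lambda>((x, u), (w, y)). ((m u x, u), (w, m w y)))"
  let ?T = "{((a0, k), hd Q)} \<union> set (consec Q) \<union> {(last Q, (l, b0))}"
  note ne = P_Q_nonempty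
  obtain a' b' where ends: "last P = (a', a)" "hd P = (b, b')" by (rule P_ends)
  obtain k' l' where ends': "hd Q = (k, k')" "last Q = (l', l)" by (rule Q_ends)
  have ends_in: "(a', a) \<in> set P" "(b, b') \<in> set P" "(k, k') \<in> set Q" "(l', l) \<in> set Q"
    using ne last_in_set[of P] hd_in_set[of P] last_in_set[of Q] hd_in_set[of Q] ends ends' by auto
  have a_b: "a \<notin> set K" "b \<notin> set K"
    using consec_set(2)[OF ends_in(1)] consec_set(1)[OF ends_in(2)] disjoint_insert by auto
  have k_l: "k \<in> set K" "l \<in> set K"
    using consec_set(1)[OF ends_in(3)] consec_set(2)[OF ends_in(4)] by auto
  have outside: "a0 \<notin> set K" "b0 \<notin> set K" using bound[of a0] bound[of b0] by (auto simp: a0_def b0_def)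
  have ends_ne: "k' \<noteq> b0" "l' \<noteq> a0" "k' \<noteq> a0" "l' \<noteq> b0"
    using consec_set[OF ends_in(3)] consec_set[OF ends_in(4)] outside by auto
  have fixed: "m u x = x" "m x u = u" if "(x, u) \<in> set Q" for x u
    using consec_set[OF that] outside by (auto simp: m_def)
  have Q_turn: "g t = t \<and> fst (snd t) \<in> set K" if t: "t \<in> set (consec Q)" for t
  proof -
    obtain x u w y where xy: "t = ((x, u), (w, y))" by (metis prod.collapse)
    then have "(x, u) \<in> set Q" "(w, y) \<in> set Q" using t consec_set by metis+
    then show ?thesis using fixed consec_set(1)[of w y K] by (simp add: xy g_def)
  qed
  have P_turn: "fst (snd t) \<notin> set K" if t: "t \<in> set (consec P)" for t
  proof -
    obtain e w y where "t = (e, (w, y))" by (metis prod.collapse)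
    then show ?thesis using consec_set(1)[of w y qs] consec_set(2)[of e "(w, y)" P] t disjoint_insert by auto
  qed
  have kl: "k \<noteq> l" "l \<noteq> k" using L by (auto simp: complex_eq_iff)
  have g_ends: "g ((a0, k), hd Q) = ((a, k), hd Q)" "g (last Q, (l, b0)) = (last Q, (l, b))"
    using kl ends_ne by (simp_all add: g_def ends' m_def)
  have mids: "{t \<in> set (consec P). fst (snd t) \<in> set K} = {}"
      "{t \<in> set (consec Q). fst (snd t) \<in> set K} = set (consec Q)" "g ` set (consec Q) = set (consec Q)"
    using P_turn Q_turn by force+
  have new: "{t \<in> {(last P, (a, k)), ((a, k), hd Q)}. fst (snd t) \<in> set K} = {((a, k), hd Q)}"
      "{t \<in> {(last Q, (l, b)), ((l, b), hd P)}. fst (snd t) \<in> set K} = {(last Q, (l, b))}"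
    using k_l a_b by (auto simp: ends ends')
  have "{t \<in> set (cyc (cyc (qs @ K))). fst (snd t) \<in> set K} =
      {((a, k), hd Q)} \<union> set (consec Q) \<union> {(last Q, (l, b))}"
    unfolding turns_insert Collect_mem_Un mids new by blast
  also have "\<dots> = g ` ?T"
    by (simp only: image_Un image_insert image_empty mids g_ends)
  also have "?T = {t \<in> ?T. fst (snd t) \<in> set K}"
  proof -
    have "{t \<in> {((a0, k), hd Q)}. fst (snd t) \<in> set K} = {((a0, k), hd Q)}"
      "{t \<in> {(last Q, (l, b0))}. fst (snd t) \<in> set K} = {(last Q, (l, b0))}"
      using k_l by (auto simp: ends')
    then show ?thesis unfolding Collect_mem_Un mids by simp
  qed
  finally have turns: "{t \<in> set (cyc (cyc (qs @ K))). fst (snd t) \<in> set K} =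
      g ` {t \<in> ?T. fst (snd t) \<in> set K}" .
  have ray: "\<exists>s>0. m v x - v = s *\<^sub>R (x - v)" for v x
  proof -
    have pos: "0 < N - L" using N L by auto
    \<comment> \<open>The stand-ins are at distance 1 from the ends of the block, so the factor is
      the length of a new edge.\<close>
    have "a - k = (N - L) *\<^sub>R (a0 - k)" "b - l = (N - L) *\<^sub>R (b0 - l)"
      by (simp_all add: complex_eq_iff a0_def b0_def)
    then have "m k a0 - k = (N - L) *\<^sub>R (a0 - k)" "m l b0 - l = (N - L) *\<^sub>R (b0 - l)"
      using kl by (simp_all only: m_def simp_thms if_True if_False)
    moreover have "m v x - v = 1 *\<^sub>R (x - v)" if "\<not> (v = k \<and> x = a0)" "\<not> (v = l \<and> x = b0)"
      using that unfolding m_def by (simp only: if_False scaleR_one)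
    ultimately show ?thesis using pos zero_less_one by blast
  qed
  show ?thesis
    by (rule crossings_move[where m = m, folded g_def, OF _ turns ray])
      (use crossings_K turns_K in \<open>simp add: a0_def b0_def\<close>)
qed

lemma knot_curve_insert: "knot_curve (qs @ K)"
proof -
  have "crossings area (set (qs @ K)) (set (cyc (cyc (qs @ K))))"
    using crossings_insert_qs crossings_insert_K by (auto simp: crossings_def)
  then show ?thesis using plane_segments_insert by (simp add: knot_curve_def)
qed

end

end

section \<open>Enlarging an arbitrary curve until the block fits\<close>

context block
begin

text \<open>The midpoint of the closing edge has positive distance from all other edges. A
  similarity that sends it to 0 and the edge to the real line, with a large enough scale, clears the
  disc that the block occupies. No vertex is lost or created, so the numbers of vertices add
  up.\<close>

lemma knot_curve_extend:
  assumes curve: "knot_curve ps" and card: "2 \<le> card (set ps)"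
  obtains qs where "knot_curve qs" "card (set qs) = card (set ps) + card (set K)"
proof -
  have length_ps: "2 \<le> length ps" using card card_length[of ps] by linarith
  then have ne: "ps \<noteq> []" by auto
  define a b where "a = last ps" and "b = hd ps"
  define c where "c = midpoint a b"
  have cyc_ps: "cyc ps = consec ps @ [(a, b)]"
    using ne by (simp add: cyc_def consec_append a_def b_def)
  have segs: "plane_segments (set ps) (consec ps @ [(a, b)])"
    using curve by (simp add: knot_curve_def cyc_ps)
  then have ab: "a \<noteq> b" "open_segment a b \<inter> set ps = {}" by (auto simp: plane_segments_def)
  then have c: "c \<in> open_segment a b" by (simp add: c_def)
  have not_in: "c \<notin> closed_segment d e" if de: "(d, e) \<in> set (consec ps)" for d e
  proof -
    have "distinct (consec ps @ [(a, b)])" using segs by (rule plane_segments_distinct)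
    then have "(d, e) \<noteq> (a, b)" using de by auto
    then have "c \<notin> open_segment d e"
      using plane_segments_disjoint[OF segs, of d e a b] de c by auto
    moreover have "c \<noteq> d" "c \<noteq> e" using consec_set[OF de] ab(2) c by auto
    ultimately show ?thesis by (simp add: closed_segment_eq_open)
  qed
  define C where "C = (\<Union>(d, e)\<in>set (consec ps). closed_segment d e)"
  have "closed C" unfolding C_def by (intro closed_UN) auto
  moreover have "c \<notin> C" using not_in by (auto simp: C_def)
  ultimately obtain \<epsilon> where \<epsilon>: "0 < \<epsilon>" "ball c \<epsilon> \<inter> C = {}"
    by (metis Compl_iff disjoint_eq_subset_Compl inf_commute open_Compl open_contains_ball)
  have R: "0 < R" using L by simp
  \<comment> \<open>The scale is \<open>2 * N / cmod (b - a)\<close>. The first summand puts the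
    ends of the edge outside the disc of radius \<open>R\<close>; the second makes the image of the
    free ball around \<open>c\<close> have radius greater than \<open>R\<close>.\<close>
  define N where "N = R + R * cmod (b - a) / \<epsilon>"
  have N: "R < N" "R * cmod (b - a) / \<epsilon> < N" "0 < N"
    using R \<epsilon>(1) ab(1) by (auto simp: N_def add_pos_nonneg)
  define \<alpha> where "\<alpha> = 2 * of_real N / (b - a)"
  define f where "f = (\<lambda>z. \<alpha> * z + - (\<alpha> * c))"
  have \<alpha>: "\<alpha> \<noteq> 0" using ab(1) N(3) by (simp add: \<alpha>_def)
  have norm_f: "cmod (f z) = 2 * N / cmod (b - a) * dist c z" for z
  proof -
    have "f z = \<alpha> * (z - c)" by (simp add: f_def algebra_simps)
    then show ?thesis using N(3)
      by (simp add: \<alpha>_def norm_mult norm_divide dist_norm norm_minus_commute)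
  qed
  have "\<alpha> * (b - a) = 2 * of_real N" using ab(1) by (simp add: \<alpha>_def)
  moreover have "f b = \<alpha> * (b - a) / 2" "f a = - (\<alpha> * (b - a)) / 2"
    by (simp_all add: f_def c_def midpoint_def scaleR_conv_of_real field_simps)
  ultimately have f_ends: "f b = of_real N" "f a = - of_real N" by simp_all
  have far: "closed_segment d' e' \<inter> cball 0 R = {}" if "(d', e') \<in> set (consec (map f ps))" for d' e'
  proof -
    from that obtain d e where de: "(d, e) \<in> set (consec ps)" "d' = f d" "e' = f e"
      by (auto simp: consec_map)
    have "R < cmod (f z)" if z: "z \<in> closed_segment d e" for z
    proof -
      have "\<epsilon> \<le> dist c z" using z de(1) \<epsilon>(2) by (force simp: C_def)
      then have "2 * N / cmod (b - a) * \<epsilon> \<le> cmod (f z)"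
        unfolding norm_f using N(3) by (intro mult_left_mono) auto
      moreover have "R * cmod (b - a) < 2 * (N * \<epsilon>)"
        using N(2) \<epsilon>(1) mult_pos_pos[OF N(3) \<epsilon>(1)] by (simp add: pos_divide_less_eq)
      then have "R < 2 * N / cmod (b - a) * \<epsilon>"
        using ab(1) by (simp add: pos_less_divide_eq mult.assoc)
      ultimately show ?thesis by simp
    qed
    moreover have "closed_segment d' e' = f ` closed_segment d e"
      unfolding de f_def by (rule segment_similarity(2)[OF \<alpha>])
    ultimately show ?thesis by fastforce
  qed
  have curve': "knot_curve (map f ps)" by (rule knot_curve_similarity[OF curve ne \<alpha> f_def])
  have ends: "hd (map f ps) = of_real N" "last (map f ps) = - of_real N"
    using ne f_ends by (simp_all add: hd_map last_map a_def b_def)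
  note insert = curve' N(1) _ ends far
  have "knot_curve (map f ps @ K)"
    by (rule knot_curve_insert[OF insert]) (use length_ps in auto)
  moreover have "set (map f ps) \<inter> set K = {}"
    by (rule disjoint_insert[OF insert]) (use length_ps in auto)
  moreover have "card (set (map f ps)) = card (set ps)"
    using \<alpha> by (simp add: f_def card_image inj_on_def)
  ultimately show ?thesis
    by (intro that[of "map f ps @ K"]) (auto simp: card_Un_disjoint)
qed

end

subsection \<open>Integer drawings\<close>

definition emb :: "int \<times> int \<Rightarrow> complex" where
  "emb p = Complex (of_int (fst p)) (of_int (snd p))"

lemma inj_emb: "inj emb"
  by (auto simp: inj_def emb_def complex_eq_iff prod_eq_iff)

fun area_int :: "int \<times> int \<Rightarrow> int \<times> int \<Rightarrow> int \<times> int \<Rightarrow> int" where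
  "area_int (a, b) (c, d) (e, f) = (c - a) * (f - b) - (d - b) * (e - a)"

lemma area_emb: "area (emb p) (emb q) (emb r) = of_int (area_int p q r)"
  by (cases p; cases q; cases r) (simp add: area_def emb_def algebra_simps)

text \<open>The line through \<open>e\<close> has both ends of \<open>f\<close> on one closed side,
  and not both on the line itself. For two noncollinear segments, disjoint interiors mean that this
  holds in one of the two orders, so the test decides disjointness without computing
  intersections.\<close>

definition one_side :: "(int \<times> int) \<times> (int \<times> int) \<Rightarrow> (int \<times> int) \<times> (int \<times> int) \<Rightarrow> bool" where
  "one_side e f \<longleftrightarrow>
     (let r = area_int (fst e) (snd e) (fst f); s = area_int (fst e) (snd e) (snd f)
      in r + s \<noteq> 0 \<and> (0 \<le> r \<and> 0 \<le> s \<or> r \<le> 0 \<and> s \<le> 0))"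

text \<open>No third vertex may lie on the whole line through an edge; in this form no test of
  betweenness occurs.\<close>

definition plane_segments_int :: "(int \<times> int) list \<Rightarrow> ((int \<times> int) \<times> (int \<times> int)) list \<Rightarrow> bool" where
  "plane_segments_int V es \<longleftrightarrow>
     list_all (\<lambda>(a, b). a \<noteq> b \<and> list_all (\<lambda>v. v = a \<or> v = b \<or> area_int a b v \<noteq> 0) V) es \<and>
     sorted_wrt (\<lambda>e f. one_side e f \<or> one_side f e) es"

text \<open>\<open>filter\<close> returns the two passages in the order of travel, which is the
  counterclockwise one only for one of the two orientations of the crossing; hence the
  disjunction.\<close>

definition crossings_int ::
  "(int \<times> int) list \<Rightarrow> (((int \<times> int) \<times> (int \<times> int)) \<times> ((int \<times> int) \<times> (int \<times> int))) list \<Rightarrow> bool" where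
  "crossings_int V ts \<longleftrightarrow>
     list_all (\<lambda>v. case filter (\<lambda>t. fst (snd t) = v) ts of
       [s, t] \<Rightarrow> snd (fst s) = v \<and> snd (fst t) = v \<and>
         (around (area_int v) (fst (fst s)) (fst (fst t)) (snd (snd s)) (snd (snd t)) \<or>
          around (area_int v) (fst (fst t)) (fst (fst s)) (snd (snd t)) (snd (snd s)))
     | _ \<Rightarrow> False) V"

text \<open>The area is affine in its last argument.\<close>

lemma area_open_segment:
  assumes "z \<in> open_segment r s"
  obtains t where "0 < t" "t < 1" "area p q z = (1 - t) * area p q r + t * area p q s"
proof -
  obtain t where "0 < t" "t < 1" "z = (1 - t) *\<^sub>R r + t *\<^sub>R s"
    using assms by (auto simp: in_segment)
  moreover from this(3) have "Re z = (1 - t) * Re r + t * Re s" "Im z = (1 - t) * Im r + t * Im s"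
    by simp_all
  then have "area p q z = (1 - t) * area p q r + t * area p q s"
    by (simp add: area_def) (simp add: algebra_simps)
  ultimately show ?thesis using that by blast
qed

lemma area_zero: "z \<in> open_segment p q \<Longrightarrow> area p q z = 0"
  by (erule area_open_segment[where p = p and q = q]) simp

text \<open>Along the open segment \<open>f\<close> the area is a proper convex combination of two
  numbers that do not have opposite signs and are not both 0, so it never vanishes, whereas it is 0
  all along \<open>e\<close>.\<close>

lemma one_side_disjoint:
  assumes "one_side e f"
  shows "open_segment (emb (fst e)) (emb (snd e)) \<inter> open_segment (emb (fst f)) (emb (snd f)) = {}"
proof -
  let ?p = "emb (fst e)" and ?q = "emb (snd e)"
  define r where "r = area ?p ?q (emb (fst f))"
  define s where "s = area ?p ?q (emb (snd f))"
  have rs: "r + s \<noteq> 0 \<and> (0 \<le> r \<and> 0 \<le> s \<or> r \<le> 0 \<and> s \<le> 0)"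
    using assms unfolding one_side_def Let_def r_def s_def area_emb
    by (metis of_int_0_le_iff of_int_add of_int_eq_0_iff of_int_le_0_iff)
  have "area ?p ?q z \<noteq> 0" if z: "z \<in> open_segment (emb (fst f)) (emb (snd f))" for z
  proof -
    obtain t where t: "0 < t" "t < 1" "area ?p ?q z = (1 - t) * r + t * s"
      unfolding r_def s_def by (rule area_open_segment[OF z])
    have "r \<noteq> 0 \<or> s \<noteq> 0" using rs by auto
    from rs consider "0 \<le> r" "0 \<le> s" | "r \<le> 0" "s \<le> 0" by blast
    then show ?thesis
    proof cases
      case 1
      then have "0 < (1 - t) * r + t * s"
        using t(1,2) rs by (cases "r = 0") (auto simp: add_pos_nonneg)
      then show ?thesis by (simp add: t(3))
    next
      case 2
      then have "(1 - t) * r + t * s < 0"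
        using t(1,2) rs
        by (cases "r = 0") (auto simp: mult_pos_neg mult_nonneg_nonpos intro!: add_neg_nonpos)
      then show ?thesis by (simp add: t(3))
    qed
  qed
  then show ?thesis using area_zero by blast
qed

lemma plane_segments_emb:
  assumes "plane_segments_int V es"
  shows "plane_segments (emb ` set V) (map (map_prod emb emb) es)"
proof -
  have "sorted_wrt (\<lambda>e f. open_segment (fst e) (snd e) \<inter> open_segment (fst f) (snd f) = {})
      (map (map_prod emb emb) es)"
    unfolding sorted_wrt_map
  proof (rule sorted_wrt_mono_rel[rotated])
    show "sorted_wrt (\<lambda>e f. one_side e f \<or> one_side f e) es"
      using assms by (simp add: plane_segments_int_def)
    fix e f assume "one_side e f \<or> one_side f e"
    then show "open_segment (fst (map_prod emb emb e)) (snd (map_prod emb emb e)) \<inter>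
        open_segment (fst (map_prod emb emb f)) (snd (map_prod emb emb f)) = {}"
      using one_side_disjoint[of e f] one_side_disjoint[of f e] by (auto simp: Int_commute)
  qed
  moreover have "emb (fst e) \<noteq> emb (snd e) \<and> open_segment (emb (fst e)) (emb (snd e)) \<inter> emb ` set V = {}"
    if "e \<in> set es" for e
  proof -
    obtain p q where e: "e = (p, q)" by (rule prod.exhaust)
    have "p \<noteq> q" and V: "\<And>v. v \<in> set V \<Longrightarrow> v = p \<or> v = q \<or> area_int p q v \<noteq> 0"
      using assms that by (auto simp: plane_segments_int_def list_all_iff e)
    have "emb v \<notin> open_segment (emb p) (emb q)" if "v \<in> set V" for v
      using V[OF that] area_zero[of "emb v" "emb p" "emb q"]
      by (auto simp: area_emb open_segment_def)
    then show ?thesis using \<open>p \<noteq> q\<close> inj_emb by (auto simp: inj_eq e)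
  qed
  ultimately show ?thesis by (simp add: plane_segments_def case_prod_beta)
qed

lemma crossings_int:
  assumes "crossings_int V ts"
  shows "crossings area_int (set V) (set ts)"
  unfolding crossings_def
proof
  fix v assume "v \<in> set V"
  with assms have *: "case filter (\<lambda>t. fst (snd t) = v) ts of
       [s, t] \<Rightarrow> snd (fst s) = v \<and> snd (fst t) = v \<and>
         (around (area_int v) (fst (fst s)) (fst (fst t)) (snd (snd s)) (snd (snd t)) \<or>
          around (area_int v) (fst (fst t)) (fst (fst s)) (snd (snd t)) (snd (snd s)))
     | _ \<Rightarrow> False"
    unfolding crossings_int_def list_all_iff by blast
  then obtain s t where "filter (\<lambda>t. fst (snd t) = v) ts = [s, t]"
    by (auto simp del: filter_eq_Cons_iff split: list.split_asm)
  moreover obtain x u w y x' u' w' y' where "s = ((x, u), (w, y))" "t = ((x', u'), (w', y'))"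
    by (metis prod.collapse)
  ultimately have f: "filter (\<lambda>t. fst (snd t) = v) ts = [((x, u), (w, y)), ((x', u'), (w', y'))]"
    by simp
  from * have uv: "u = v" "u' = v" and ar: "around (area_int v) x x' y y' \<or> around (area_int v) x' x y' y"
    unfolding f by simp_all
  have "set (filter (\<lambda>t. fst (snd t) = v) ts) = {((x, u), (w, y)), ((x', u'), (w', y'))}"
    unfolding f by simp
  then have set: "{t \<in> set ts. fst (snd t) = v} = {((x, u), (w, y)), ((x', u'), (w', y'))}"
    by simp
  moreover have "((x, u), (w, y)) \<in> {t \<in> set ts. fst (snd t) = v}"
      "((x', u'), (w', y')) \<in> {t \<in> set ts. fst (snd t) = v}"
    unfolding set by simp_all
  then have "w = v" "w' = v" by simp_all
  ultimately have set: "{t \<in> set ts. fst (snd t) = v} = {((x, v), (v, y)), ((x', v), (v, y'))}"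
    using uv by simp
  then have set': "{t \<in> set ts. fst (snd t) = v} = {((x', v), (v, y')), ((x, v), (v, y))}"
    by (simp add: insert_commute)
  from ar show "\<exists>x y x' y'. {t \<in> set ts. fst (snd t) = v} = {((x, v), (v, y)), ((x', v), (v, y'))} \<and>
      around (area_int v) x x' y y'"
    using set set' by blast
qed

lemma crossings_emb:
  assumes "crossings_int V ts"
  shows "crossings area (emb ` set V) (set (map (map_prod (map_prod emb emb) (map_prod emb emb)) ts))"
  using crossings_image[OF crossings_int[OF assms] inj_emb, of area] by (simp add: area_emb)

definition knot_curve_int :: "(int \<times> int) list \<Rightarrow> bool" where
  "knot_curve_int ps \<longleftrightarrow> ps \<noteq> [] \<and> plane_segments_int ps (cyc ps) \<and> crossings_int ps (cyc (cyc ps))"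

lemma knot_curve_emb:
  assumes "knot_curve_int ps"
  shows "knot_curve (map emb ps)"
  using assms plane_segments_emb[of ps "cyc ps"] crossings_emb[of ps "cyc (cyc ps)"]
  by (simp add: knot_curve_int_def knot_curve_def cyc_map)

text \<open>
  The lists are integer drawings, obtained by rounding barycentric embeddings, of closed braid shadows:
  the Turk's heads \<open>(\<sigma>\<^sub>1\<sigma>\<^sub>2)\<^sup>k\<close> with \<open>k = 4, 5, 7\<close>, \<open>(\<sigma>\<^sub>1\<sigma>\<^sub>2\<sigma>\<^sub>3)\<^sup>k\<close> with \<open>k = 3, 5\<close> and
  \<open>(\<sigma>\<^sub>1\<sigma>\<^sub>2\<sigma>\<^sub>3\<sigma>\<^sub>4)\<^sup>3\<close>, and two irregular words on four strands for 11 and 13 vertices. The block below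
  is the Turk's head with 8 vertices, cut open at an edge.
\<close>

lemma knot_curve_base:
  fixes n :: nat
  assumes "8 \<le> n" "n < 16"
  obtains ps where "knot_curve ps" "card (set ps) = n"
proof -
  have base: thesis if "knot_curve_int ps" "length (remdups ps) = n" for ps
  proof (rule \<open>\<And>ps. knot_curve ps \<Longrightarrow> card (set ps) = n \<Longrightarrow> thesis\<close>)
    show "knot_curve (map emb ps)" using that(1) by (rule knot_curve_emb)
    have "card (set (map emb ps)) = card (set ps)"
      using inj_emb by (simp add: card_image inj_on_subset)
    then show "card (set (map emb ps)) = n" using that(2) by (simp add: length_remdups_card_conv)
  qed
  consider "n = 8" | "n = 9" | "n = 10" | "n = 11" | "n = 12" | "n = 13" | "n = 14" | "n = 15"
    using assms by linarith
  then show thesis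
  proof cases
    case 1
    show thesis
    proof (rule base)
      show "knot_curve_int
        [(3,7), (6,9), (8,3), (4,4), (2,4), (0,6), (6,9), (6,7), (4,4), (2,0), (0,6), (3,7),
         (6,7), (8,3), (2,0), (2,4)]"
        by code_simp
    qed (simp add: 1)
  next
    case 2
    show thesis
    proof (rule base)
      show "knot_curve_int
        [(0,1), (2,7), (5,5), (7,4), (7,0), (0,1), (2,3), (5,4), (7,4), (8,6), (2,7), (2,3),
         (3,2), (7,0), (8,6), (5,5), (5,4), (3,2)]"
        by code_simp
    qed (simp add: 2)
  next
    case 3
    show thesis
    proof (rule base)
      show "knot_curve_int
        [(6,5), (8,4), (5,0), (4,1), (2,4), (0,6), (5,8), (6,5), (6,2), (5,0), (1,1), (2,4),
         (3,6), (5,8), (8,4), (6,2), (4,1), (1,1), (0,6), (3,6)]"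
        by code_simp
    qed (simp add: 3)
  next
    case 4
    show thesis
    proof (rule base)
      show "knot_curve_int
        [(5,1), (2,0), (0,4), (2,5), (5,5), (8,6), (7,1), (5,1), (3,2), (0,4), (3,8), (5,5),
         (4,3), (3,2), (2,0), (7,1), (7,3), (4,3), (2,5), (3,8), (8,6), (7,3)]"
        by code_simp
    qed (simp add: 4)
  next
    case 5
    show thesis
    proof (rule base)
      show "knot_curve_int
        [(5,0), (0,7), (4,7), (7,8), (9,10), (9,11), (0,7), (6,3), (11,3), (14,4), (9,11),
         (8,10), (7,8), (11,6), (14,4), (5,0), (6,3), (7,5), (11,6), (9,10), (8,10), (4,7),
         (7,5), (11,3)]"
        by code_simp
    qed (simp add: 5)
  next
    case 6
    show thesis
    proof (rule base)
      show "knot_curve_int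
        [(0,9), (7,14), (8,11), (6,5), (5,4), (3,1), (11,0), (11,6), (7,5), (5,4), (4,6),
         (6,11), (7,14), (14,9), (11,6), (8,1), (3,1), (0,9), (6,11), (8,11), (14,9), (11,0),
         (8,1), (7,5), (6,5), (4,6)]"
        by code_simp
    qed (simp add: 6)
  next
    case 7
    show thesis
    proof (rule base)
      show "knot_curve_int
        [(13,7), (13,3), (7,0), (7,4), (3,7), (0,10), (4,15), (8,14), (12,11), (15,9), (13,3),
         (9,4), (7,4), (1,3), (0,10), (4,13), (8,14), (11,14), (15,9), (13,7), (9,4), (7,0),
         (1,3), (3,7), (4,13), (4,15), (11,14), (12,11)]"
        by code_simp
    qed (simp add: 7)
  next
    case 8
    show thesis
    proof (rule base)
      show "knot_curve_int
        [(10,0), (11,5), (10,10), (9,13), (7,17), (4,20), (0,8), (5,7), (8,8), (10,10), (13,12),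
         (16,19), (4,20), (4,11), (5,10), (8,8), (11,5), (20,7), (16,19), (7,17), (6,13), (5,10),
         (5,7), (10,0), (20,7), (13,12), (9,13), (6,13), (4,11), (0,8)]"
        by code_simp
    qed (simp add: 8)
  qed
qed

text \<open>The first and last points are the only ones with extreme abscissa. The loose ends of the
  cut edge can therefore continue straight outwards, to the left and to the right.\<close>

definition K8_int :: "(int \<times> int) list" where
  "K8_int = [(-3, 0), (-1, -1), (0, -2), (2, -3), (3, 0), (0, 3), (-1, -1), (-1, -3), (2, -3), (2, -1),
     (0, 3), (-3, 0), (-1, -3), (0, -2), (2, -1), (3, 0)]"

text \<open>3 is the abscissa of the right end. The largest norm is the square root of 13, at the
  point (2, -3), and 4 is an integer above it, so that the bound can be checked on squares.\<close>

interpretation K8: block 3 4 "map emb K8_int"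
proof
  have "plane_segments_int K8_int (consec K8_int)" by code_simp
  then show "plane_segments (set (map emb K8_int)) (consec (map emb K8_int))"
    using plane_segments_emb by (simp add: consec_map)
  have "crossings_int K8_int (consec (consec ([(-4, 0)] @ K8_int @ [(4, 0)])))" by code_simp
  from crossings_emb[OF this]
  have "crossings area (set (map emb K8_int))
      (set (consec (consec (map emb ([(-4, 0)] @ K8_int @ [(4, 0)])))))"
    by (simp only: consec_map set_map)
  moreover have "map emb ([(-4, 0)] @ K8_int @ [(4, 0)]) =
      [- of_real (3 + 1)] @ map emb K8_int @ [of_real (3 + 1)]"
    by (simp add: emb_def complex_eq_iff)
  ultimately show "crossings area (set (map emb K8_int))
      (set (consec (consec ([- of_real (3 + 1)] @ map emb K8_int @ [of_real (3 + 1)]))))"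
    by (simp only:)
  show "hd (map emb K8_int) = - of_real 3" "last (map emb K8_int) = of_real 3"
    by (simp_all add: K8_int_def emb_def complex_eq_iff)
  fix z assume "z \<in> set (map emb K8_int)"
  then obtain p where p: "p \<in> set K8_int" "z = emb p" by auto
  have "list_all (\<lambda>p. - 3 \<le> fst p \<and> fst p \<le> 3 \<and> (fst p)\<^sup>2 + (snd p)\<^sup>2 \<le> 4\<^sup>2) K8_int" by code_simp
  then have bounds: "- 3 \<le> fst p" "fst p \<le> 3" "(fst p)\<^sup>2 + (snd p)\<^sup>2 \<le> 4\<^sup>2"
    using p(1) by (auto simp: list_all_iff)
  then have "real_of_int ((fst p)\<^sup>2 + (snd p)\<^sup>2) \<le> real_of_int (4\<^sup>2)"
    by (simp only: of_int_le_iff)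
  then have "cmod z \<le> 4"
    by (simp add: p(2) emb_def cmod_def real_le_lsqrt)
  then show "- 3 \<le> Re z \<and> Re z \<le> 3 \<and> cmod z \<le> 4"
    using bounds(1,2) by (simp add: p(2) emb_def)
qed (simp_all add: K8_int_def)

text \<open>Each splice adds exactly the 8 vertices of the block, so eight consecutive base values
  reach every residue modulo 8.\<close>

lemma knot_curve_exists:
  fixes n :: nat
  assumes "8 \<le> n"
  shows "\<exists>ps. knot_curve ps \<and> card (set ps) = n"
  using assms
proof (induction n rule: less_induct)
  case (less n)
  show ?case
  proof (cases "n < 16")
    case True
    with less.prems obtain ps where "knot_curve ps" "card (set ps) = n" by (rule knot_curve_base)
    then show ?thesis by blast
  next
    case False
    then obtain ps where ps: "knot_curve ps" "card (set ps) = n - 8"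
      using less.IH[of "n - 8"] by force
    have "2 \<le> card (set ps)" using ps(2) False by simp
    with ps(1) obtain qs where
      qs: "knot_curve qs" "card (set qs) = card (set ps) + card (set (map emb K8_int))"
      by (rule K8.knot_curve_extend)
    have "card (set (map emb K8_int)) = length (remdups K8_int)"
      using inj_emb by (simp add: card_image inj_on_subset length_remdups_card_conv)
    also have "\<dots> = 8" by code_simp
    finally have "card (set qs) = n" using qs(2) ps(2) False by simp
    with qs(1) show ?thesis by blast
  qed
qed

theorem theorem3:
  fixes v :: nat
  assumes "v \<ge> 8"
  shows "\<exists>V E. lune_free_graph V E \<and> knot_graph V E \<and> card V = v"
proof -
  obtain ps where ps: "knot_curve ps" "card (set ps) = v"
    using knot_curve_exists[OF assms] by blast
  moreover have "ps \<noteq> []" using ps(2) assms by auto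
  ultimately show ?thesis
    using lune_free_segment_paths knot_graph_segment_paths by blast
qed

end
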